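(* Let $\Omega$ be a domain in $\mathbb{C}^n$ and let $p\in\Omega$ be fixed. Assume that $\Omega$ is uniformly dominated by an invariant metric $F$. For $\varphi\in\mathrm{Aut}(\Omega)$ let $$\tau_\varphi=[d\varphi(p)]^{-1}\circ(\varphi(\cdot)-\varphi(p)):\Omega\to\mathbb{C}^n .$$ Then $\mathcal{S}=\{\tau_\varphi:\Omega\to\mathbb{C}^n : \varphi\in\mathrm{Aut}(\Omega)\}$ is a normal family.
   Context: $\mathrm{Aut}(\Omega)$ is the group of holomorphic automorphisms of $\Omega$, and $d\varphi(p)$ is the complex Jacobian matrix of $\varphi$ at $p$. A (complex Finsler) metric on $\Omega$ is an upper semicontinuous function $F$ on $\Omega\times\mathbb{C}^n$ such that $F(x;v)\ge0$, $F(x;v)=0$ only if $v=0$, and $F(x;cv)=|c|F(x;v)$ for $c\in\mathbb{C}$. It is invariant if $F(\varphi(x);d\varphi(x)v)=F(x;v)$ for all $\varphi\in\mathrm{Aut}(\Omega)$, $x\in\Omega$, $v\in\mathbb{C}^n$. The indicatrix is $I_{\Omega,F}(x)=\{v\in\mathbb{C}^n:F(x;v)<1\}$; the induced distance is $d_{\Omega,F}(x,y)=\inf\int_0^1F(c(t);c'(t))\,dt$, the infimum over piecewise differentiable real curves $c:[0,1]\to\Omega$ joining $x$ and $y$; and $B_{\Omega,F}(x;r)=\{y\in\Omega:d_{\Omega,F}(x,y)<r\}$. $\Omega$ is uniformly dominated by $F$ if $F$ is complete (i.e. $d_{\Omega,F}$ is Cauchy complete) and for each $r>0$ there is $\lambda(r)>0$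 such that $\{y-x:y\in B_{\Omega,F}(x;r)\}\subset\lambda(r)I_{\Omega,F}(x)$ for all $x\in\Omega$. A family of holomorphic maps $\Omega\to\mathbb{C}^n$ is normal if every sequence in it has a subsequence converging uniformly on compact subsets of $\Omega$ to a holomorphic map into $\mathbb{C}^n$. *)

theory Defs
  imports "HOL-Analysis.Analysis"
begin

definition holomorphic_map_on :: "(complex ^ 'n \<Rightarrow> complex ^ 'm) \<Rightarrow> (complex ^ 'n) set \<Rightarrow> bool"
  where "holomorphic_map_on f \<Omega> \<longleftrightarrow>
    (\<forall>z\<in>\<Omega>. \<exists>A :: complex ^ 'n ^ 'm. (f has_derivative (\<lambda>h. A *v h)) (at z))"

text \<open>
  Maps on \<open>\<Omega>\<close> are total functions whose values outside \<open>\<Omega>\<close> are irrelevant.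
  For a map that is holomorphic near \<open>p\<close>, the library's \<^term>\<open>jacobian f (at p)\<close>, taken at
  complex vector type, has the columns \<open>df(p)(e\<^sub>j)\<close>: it is the complex Jacobian matrix.
\<close>

definition holomorphic_Aut :: "(complex ^ 'n) set \<Rightarrow> (complex ^ 'n \<Rightarrow> complex ^ 'n) set"
  where "holomorphic_Aut \<Omega> =
    {\<phi>. bij_betw \<phi> \<Omega> \<Omega> \<and> holomorphic_map_on \<phi> \<Omega> \<and> holomorphic_map_on (inv_into \<Omega> \<phi>) \<Omega>}"

definition upper_semicontinuous_on :: "'a::topological_space set \<Rightarrow> ('a \<Rightarrow> real) \<Rightarrow> bool"
  where "upper_semicontinuous_on S f \<longleftrightarrow>
    (\<forall>x\<in>S. \<forall>a. f x < a \<longrightarrow> (\<forall>\<^sub>F y in at x within S. f y < a))"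

definition finsler_metric ::
    "(complex ^ 'n) set \<Rightarrow> (complex ^ 'n \<Rightarrow> complex ^ 'n \<Rightarrow> real) \<Rightarrow> bool"
  where "finsler_metric \<Omega> F \<longleftrightarrow>
    upper_semicontinuous_on (\<Omega> \<times> UNIV) (\<lambda>(x, v). F x v) \<and>
    (\<forall>x\<in>\<Omega>. \<forall>v. 0 \<le> F x v) \<and>
    (\<forall>x\<in>\<Omega>. \<forall>v. F x v = 0 \<longrightarrow> v = 0) \<and>
    (\<forall>x\<in>\<Omega>. \<forall>v. \<forall>c. F x (c *s v) = cmod c * F x v)"

definition invariant_metric ::
    "(complex ^ 'n) set \<Rightarrow> (complex ^ 'n \<Rightarrow> complex ^ 'n \<Rightarrow> real) \<Rightarrow> bool"
  where "invariant_metric \<Omega> F \<longleftrightarrow>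
    (\<forall>\<phi>\<in>holomorphic_Aut \<Omega>. \<forall>x\<in>\<Omega>. \<forall>v. F (\<phi> x) (jacobian \<phi> (at x) *v v) = F x v)"

definition indicatrix ::
    "(complex ^ 'n \<Rightarrow> complex ^ 'n \<Rightarrow> real) \<Rightarrow> complex ^ 'n \<Rightarrow> (complex ^ 'n) set"
  where "indicatrix F x = {v. F x v < 1}"

definition curves_joining ::
    "(complex ^ 'n) set \<Rightarrow> complex ^ 'n \<Rightarrow> complex ^ 'n \<Rightarrow> (real \<Rightarrow> complex ^ 'n) set"
  where "curves_joining \<Omega> x y =
    {c. c piecewise_differentiable_on {0..1} \<and> c ` {0..1} \<subseteq> \<Omega> \<and> c 0 = x \<and> c 1 = y}"

text \<open>
  The length is a Lebesgue integral with values in \<open>[0,\<infinity>]\<close>, since the derivative of a piecewise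
  differentiable curve need not be integrable. The finitely many parameters at which the curve
  is not differentiable do not affect it.
\<close>

definition finsler_length ::
    "(complex ^ 'n \<Rightarrow> complex ^ 'n \<Rightarrow> real) \<Rightarrow> (real \<Rightarrow> complex ^ 'n) \<Rightarrow> ennreal"
  where "finsler_length F c =
    (\<integral>\<^sup>+ t \<in> {0..1}. ennreal (F (c t) (vector_derivative c (at t))) \<partial>lborel)"

text \<open>
  On a domain the infimum is finite: two points are joined by a polygon, and an upper
  semicontinuous \<open>F\<close> is bounded above on compact sets. Hence no information is lost by
  \<^const>\<open>enn2real\<close>.
\<close>

definition finsler_dist ::
    "(complex ^ 'n) set \<Rightarrow> (complex ^ 'n \<Rightarrow> complex ^ 'n \<Rightarrow> real) \<Rightarrow> complex ^ 'n \<Rightarrow> complex ^ 'n \<Rightarrow> real"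
  where "finsler_dist \<Omega> F x y = enn2real (INF c \<in> curves_joining \<Omega> x y. finsler_length F c)"

definition finsler_ball ::
    "(complex ^ 'n) set \<Rightarrow> (complex ^ 'n \<Rightarrow> complex ^ 'n \<Rightarrow> real) \<Rightarrow> complex ^ 'n \<Rightarrow> real \<Rightarrow> (complex ^ 'n) set"
  where "finsler_ball \<Omega> F x r = {y \<in> \<Omega>. finsler_dist \<Omega> F x y < r}"

text \<open>
  Completeness means that \<open>\<Omega>\<close> with its induced distance is a complete metric space. The first
  conjunct says that the induced distance is a distance. Nonnegativity, symmetry and the triangle
  inequality are automatic on a domain, but \<open>d(x,y) = 0 \<Longrightarrow> x = y\<close> is not: a merely
  upper semicontinuous \<open>F\<close> may have values arbitrarily close to 0 near a given unit vector.
\<close>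

definition finsler_complete ::
    "(complex ^ 'n) set \<Rightarrow> (complex ^ 'n \<Rightarrow> complex ^ 'n \<Rightarrow> real) \<Rightarrow> bool"
  where "finsler_complete \<Omega> F \<longleftrightarrow>
    Metric_space \<Omega> (finsler_dist \<Omega> F) \<and> Metric_space.mcomplete \<Omega> (finsler_dist \<Omega> F)"

definition uniformly_dominated ::
    "(complex ^ 'n) set \<Rightarrow> (complex ^ 'n \<Rightarrow> complex ^ 'n \<Rightarrow> real) \<Rightarrow> bool"
  where "uniformly_dominated \<Omega> F \<longleftrightarrow>
    finsler_complete \<Omega> F \<and>
    (\<forall>r>0. \<exists>l>0. \<forall>x\<in>\<Omega>. (\<lambda>y. y - x) ` finsler_ball \<Omega> F x r \<subseteq> (\<lambda>v. l *\<^sub>R v) ` indicatrix F x)"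

definition normal_family :: "(complex ^ 'n) set \<Rightarrow> (complex ^ 'n \<Rightarrow> complex ^ 'm) set \<Rightarrow> bool"
  where "normal_family \<Omega> \<S> \<longleftrightarrow>
    (\<forall>f\<in>\<S>. holomorphic_map_on f \<Omega>) \<and>
    (\<forall>f :: nat \<Rightarrow> _. range f \<subseteq> \<S> \<longrightarrow>
      (\<exists>r g. strict_mono r \<and> holomorphic_map_on g \<Omega> \<and>
        (\<forall>K. compact K \<and> K \<subseteq> \<Omega> \<longrightarrow> uniform_limit K (f \<circ> r) g sequentially)))"

definition rescaling ::
    "complex ^ 'n \<Rightarrow> (complex ^ 'n \<Rightarrow> complex ^ 'n) \<Rightarrow> complex ^ 'n \<Rightarrow> complex ^ 'n"
  where "rescaling p \<phi> = (\<lambda>z. matrix_inv (jacobian \<phi> (at p)) *v (\<phi> z - \<phi> p))"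

end

theory Submission
  imports Defs "HOL-Complex_Analysis.Great_Picard"
begin

text \<open>
  Fix \<open>r\<close> such that the \<open>F\<close>-ball of radius \<open>r\<close> around \<open>p\<close> is bounded in the Euclidean sense, by
  \<open>M\<close>. Let \<open>y\<close> have distance less than \<open>R\<close> from \<open>p\<close>, and write \<open>q = \<phi>(p)\<close>, \<open>u = \<phi>(y) - \<phi>(p)\<close> and
  \<open>l = \<lambda>(R + r)\<close>. Domination at a point \<open>x = q + \<xi>u\<close> of \<open>B(q; r)\<close> says
  \<open>|1 - \<xi>| F(x; u) = F(x; \<phi>(y) - x) < l\<close>, so moving from \<open>q\<close> along the complex line in direction \<open>u\<close>
  is cheap: for a constant \<open>c\<close> depending only on \<open>l\<close> and \<open>r\<close>, the disc \<open>q + \<zeta>u\<close>, \<open>|\<zeta>| \<le> c\<close>, never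
  leaves \<open>B(q; r)\<close>. Since \<open>\<phi>\<inverse>\<close> maps this disc into \<open>B(p; r)\<close>, the Cauchy estimate bounds its
  derivative \<open>d\<phi>(p)\<inverse>u = \<tau>\<^sub>\<phi>(y)\<close> at \<open>\<zeta> = 0\<close> by a multiple of \<open>M / c\<close>. Hence the rescalings are uniformly
  bounded on every \<open>F\<close>-ball around \<open>p\<close>, and Montel's theorem applies.

  The indicatrix of a merely upper semicontinuous \<open>F\<close> may be unbounded, so domination at \<open>\<phi>(p)\<close>
  alone does not bound \<open>\<tau>\<^sub>\<phi>(y)\<close>.
\<close>

section \<open>Montel's theorem in several variables\<close>

lemma norm_vector_scalar_mult: "norm (c *s x) = cmod c * norm x" for x :: "complex ^ 'n"
  by (simp add: norm_vec_def L2_set_def norm_mult power_mult_distrib sum_distrib_left[symmetric]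
      real_sqrt_mult)

lemma scaleR_vector_scalar_mult: "r *\<^sub>R x = complex_of_real r *s x" for x :: "complex ^ 'n"
  by (simp add: vec_eq_iff) (simp add: scaleR_conv_of_real)

lemma matrix_vector_mult_axis_component:
  "(A *v axis j 1) $ i = A $ i $ j" for A :: "complex ^ 'n ^ 'm"
  by (simp add: matrix_vector_mult_def axis_def if_distrib cong: if_cong)

lemma jacobian_eqI:
  fixes A :: "complex ^ 'n ^ 'm"
  assumes "(f has_derivative (\<lambda>h. A *v h)) (at z)"
  shows "jacobian f (at z) = A"
proof -
  have "frechet_derivative f (at z) = (\<lambda>h. A *v h)"
    using frechet_derivative_at[OF assms] by simp
  then show ?thesis
    by (simp add: jacobian_def matrix_def vec_eq_iff matrix_vector_mult_axis_component)
qed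

text \<open>The definition of holomorphy only provides some complex matrix at each point. Uniqueness
  of the derivative identifies it with \<open>jacobian\<close>, so that later arguments can work
  with one named matrix.\<close>

lemma holomorphic_map_on_jacobian:
  assumes "holomorphic_map_on f \<Omega>" "z \<in> \<Omega>"
  shows "(f has_derivative (\<lambda>h. jacobian f (at z) *v h)) (at z)"
  using assms jacobian_eqI unfolding holomorphic_map_on_def by metis

lemma holomorphic_map_onI:
  assumes "\<And>z. z \<in> \<Omega> \<Longrightarrow> (f has_derivative (\<lambda>h. D z *v h)) (at z)"
  shows "holomorphic_map_on f \<Omega>"
  using assms unfolding holomorphic_map_on_def by auto

lemma holomorphic_map_on_subset:
  "holomorphic_map_on f \<Omega> \<Longrightarrow> S \<subseteq> \<Omega> \<Longrightarrow> holomorphic_map_on f S"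
  by (simp add: holomorphic_map_on_def subset_iff)

lemma holomorphic_map_on_continuous_on:
  "holomorphic_map_on f \<Omega> \<Longrightarrow> continuous_on \<Omega> f"
  by (meson continuous_at_imp_continuous_on has_derivative_continuous holomorphic_map_on_jacobian)

section \<open>Cauchy estimates along complex lines and on balls\<close>

lemma has_field_derivative_along_line:
  fixes f :: "complex ^ 'n \<Rightarrow> complex ^ 'm"
  assumes "(f has_derivative (\<lambda>h. A *v h)) (at (a + \<zeta> *s v))"
  shows "((\<lambda>\<zeta>. f (a + \<zeta> *s v) $ i) has_field_derivative (A *v v) $ i) (at \<zeta>)"
proof -
  have "linear (\<lambda>k::complex. k *s v)"
    by (rule linearI) (simp_all add: vec_eq_iff algebra_simps)
  then have "bounded_linear (\<lambda>k::complex. k *s v)"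
    by (simp add: linear_conv_bounded_linear)
  then have "((\<lambda>\<zeta>. a + \<zeta> *s v) has_derivative (\<lambda>k. k *s v)) (at \<zeta>)"
    by (auto intro!: derivative_eq_intros bounded_linear_imp_has_derivative)
  then have "((\<lambda>\<zeta>. f (a + \<zeta> *s v)) has_derivative (\<lambda>k. A *v (k *s v))) (at \<zeta>)"
    by (rule has_derivative_compose) (rule assms)
  then have "((\<lambda>\<zeta>. f (a + \<zeta> *s v) $ i) has_derivative (\<lambda>k. (A *v (k *s v)) $ i)) (at \<zeta>)"
    by (rule bounded_linear.has_derivative[OF bounded_linear_vec_nth])
  \<comment> \<open>Complex linearity of \<open>A\<close> pulls \<open>k\<close> out of
    \<open>A *v (k *s v)\<close>; this turns the real derivative into a complex one.\<close>
  then show ?thesis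
    unfolding has_field_derivative_def
    by (rule has_derivative_eq_rhs) (simp add: vector_scalar_commute mult.commute fun_eq_iff)
qed

text \<open>The one-variable Cauchy inequality bounds each coordinate of the restriction to the line
  by \<open>M / r\<close>; summing over the coordinates produces the factor \<open>CARD('m)\<close>.
  Holomorphy is asked for only on the disc itself, because in the application a single disc, and no
  ball of controlled size, is known to lie in \<Omega>.\<close>

lemma cauchy_estimate_along_line:
  fixes f :: "complex ^ 'n \<Rightarrow> complex ^ 'm"
  assumes "0 < r"
    and hol: "holomorphic_map_on f ((\<lambda>\<zeta>. a + \<zeta> *s v) ` cball 0 r)"
    and bound: "\<And>\<zeta>. cmod \<zeta> = r \<Longrightarrow> norm (f (a + \<zeta> *s v)) \<le> M"
  shows "norm (jacobian f (at a) *v v) \<le> real CARD('m) * M / r"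
proof -
  have der: "((\<lambda>\<zeta>. f (a + \<zeta> *s v) $ i) has_field_derivative
      (jacobian f (at (a + \<zeta> *s v)) *v v) $ i) (at \<zeta>)" if "\<zeta> \<in> cball 0 r" for \<zeta> i
    using that by (intro has_field_derivative_along_line holomorphic_map_on_jacobian[OF hol]) auto
  have "cmod ((jacobian f (at a) *v v) $ i) \<le> M / r" for i
  proof -
    have "(\<lambda>\<zeta>. f (a + \<zeta> *s v) $ i) holomorphic_on ball 0 r"
      using der unfolding holomorphic_on_open[OF open_ball] by (meson ball_subset_cball subsetD)
    moreover have "continuous_on (cball 0 r) (\<lambda>\<zeta>. f (a + \<zeta> *s v) $ i)"
      using der by (auto intro!: continuous_at_imp_continuous_on DERIV_isCont)
    ultimately have "norm ((deriv ^^ 1) (\<lambda>\<zeta>. f (a + \<zeta> *s v) $ i) 0) \<le> fact 1 * M / r ^ 1"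
      using \<open>0 < r\<close> bound
      by (intro Cauchy_inequality) (auto intro: order_trans[OF Finite_Cartesian_Product.norm_nth_le])
    moreover have "deriv (\<lambda>\<zeta>. f (a + \<zeta> *s v) $ i) 0 = (jacobian f (at a) *v v) $ i"
      using DERIV_imp_deriv[OF der[of 0 i]] \<open>0 < r\<close> by simp
    ultimately show ?thesis
      by simp
  qed
  then have "(\<Sum>i\<in>UNIV. cmod ((jacobian f (at a) *v v) $ i)) \<le> of_nat CARD('m) * (M / r)"
    by (intro sum_bounded_above)
  then show ?thesis
    using L2_set_le_sum[of UNIV "\<lambda>i. cmod ((jacobian f (at a) *v v) $ i)"]
    by (simp add: norm_vec_def)
qed

text \<open>From a point of the ball of radius \<rho>, the disc in direction \<open>v\<close> with
  parameter radius \<open>\<rho> / norm v\<close> has Euclidean radius \<rho> and therefore stays in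
  the ball of radius 2\<rho>.\<close>

lemma cauchy_estimate_ball:
  fixes f :: "complex ^ 'n \<Rightarrow> complex ^ 'm"
  assumes hol: "holomorphic_map_on f \<Omega>" and "0 < \<rho>" and sub: "cball a (2 * \<rho>) \<subseteq> \<Omega>"
    and bound: "\<And>z. z \<in> cball a (2 * \<rho>) \<Longrightarrow> norm (f z) \<le> M" and x: "x \<in> cball a \<rho>"
  shows "norm (jacobian f (at x) *v v) \<le> real CARD('m) * M / \<rho> * norm v"
proof (cases "v = 0")
  case False
  have in_ball: "x + \<zeta> *s v \<in> cball a (2 * \<rho>)" if "cmod \<zeta> \<le> \<rho> / norm v" for \<zeta>
  proof -
    have "norm (\<zeta> *s v) \<le> \<rho>"
      using that False by (simp add: norm_vector_scalar_mult pos_le_divide_eq)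
    then show ?thesis
      using x norm_triangle_ineq4[of "a - x" "\<zeta> *s v"] by (simp add: dist_norm algebra_simps)
  qed
  have "norm (jacobian f (at x) *v v) \<le> real CARD('m) * M / (\<rho> / norm v)"
  proof (rule cauchy_estimate_along_line)
    show "holomorphic_map_on f ((\<lambda>\<zeta>. x + \<zeta> *s v) ` cball 0 (\<rho> / norm v))"
      by (rule holomorphic_map_on_subset[OF hol]) (use in_ball sub in auto)
  qed (use in_ball bound False \<open>0 < \<rho>\<close> in auto)
  then show ?thesis
    by simp
qed simp

text \<open>The mean value inequality on a convex ball turns the Cauchy estimate into a Lipschitz
  constant that depends on \<open>f\<close> only through \<open>M\<close>. This is the
  equicontinuity behind Montel's theorem.\<close>

lemma holomorphic_map_on_lipschitz_ball:
  fixes f :: "complex ^ 'n \<Rightarrow> complex ^ 'm"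
  assumes hol: "holomorphic_map_on f \<Omega>" and "0 < \<rho>" and sub: "cball a (2 * \<rho>) \<subseteq> \<Omega>"
    and bound: "\<And>z. z \<in> cball a (2 * \<rho>) \<Longrightarrow> norm (f z) \<le> M"
    and "x \<in> cball a \<rho>" "y \<in> cball a \<rho>"
  shows "norm (f x - f y) \<le> real CARD('m) * M / \<rho> * norm (x - y)"
proof (rule differentiable_bound[where S = "cball a \<rho>" and f' = "\<lambda>x h. jacobian f (at x) *v h"])
  fix z assume z: "z \<in> cball a \<rho>"
  then have "z \<in> \<Omega>"
    using sub \<open>0 < \<rho>\<close> by (auto simp: subset_iff)
  then show "(f has_derivative (\<lambda>h. jacobian f (at z) *v h)) (at z within cball a \<rho>)"
    by (rule has_derivative_at_withinI[OF holomorphic_map_on_jacobian[OF hol]])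
  show "onorm (\<lambda>h. jacobian f (at z) *v h) \<le> real CARD('m) * M / \<rho>"
    using cauchy_estimate_ball[OF hol \<open>0 < \<rho>\<close> sub bound z] by (intro onorm_le) auto
qed (use assms in auto)

section \<open>Locally uniform limits of holomorphic maps\<close>

lemma holomorphic_map_on_diff:
  assumes "holomorphic_map_on f \<Omega>" "holomorphic_map_on g \<Omega>"
  shows "holomorphic_map_on (\<lambda>z. f z - g z) \<Omega>"
proof (rule holomorphic_map_onI)
  show "((\<lambda>z. f z - g z) has_derivative
      (\<lambda>h. (jacobian f (at z) - jacobian g (at z)) *v h)) (at z)" if "z \<in> \<Omega>" for z
    unfolding matrix_vector_mult_diff_rdistrib
    using assms that by (intro has_derivative_diff holomorphic_map_on_jacobian)
qed

text \<open>The Cauchy estimate for the differences \<open>h m - h n\<close> makes the Jacobians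
  uniformly Cauchy on the smaller ball, so that limit and derivative may be interchanged.\<close>

lemma holomorphic_map_on_ball_uniform_limit:
  fixes h :: "nat \<Rightarrow> complex ^ 'n \<Rightarrow> complex ^ 'm"
  assumes hol: "\<And>n. holomorphic_map_on (h n) \<Omega>" and "0 < \<rho>" and sub: "cball a (2 * \<rho>) \<subseteq> \<Omega>"
    and lim: "uniform_limit (cball a (2 * \<rho>)) h g sequentially"
  shows "holomorphic_map_on g (ball a \<rho>)"
proof -
  define J where "J n x = jacobian (h n) (at x)" for n x
  define C where "C = real CARD('m) / \<rho>"
  have "C > 0"
    using \<open>0 < \<rho>\<close> by (simp add: C_def)
  have J_diff: "(J m x - J n x) = jacobian (\<lambda>z. h m z - h n z) (at x)" if "x \<in> \<Omega>" for m n x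
    unfolding J_def
    by (rule jacobian_eqI[symmetric], unfold matrix_vector_mult_diff_rdistrib)
      (intro has_derivative_diff holomorphic_map_on_jacobian[OF hol that])
  have x\<Omega>: "x \<in> \<Omega>" if "x \<in> cball a \<rho>" for x
    using that sub \<open>0 < \<rho>\<close> by (auto simp: subset_iff)
  have Cauchy_J: "\<exists>N. \<forall>m\<ge>N. \<forall>n\<ge>N. \<forall>x\<in>cball a \<rho>. \<forall>v. norm ((J m x - J n x) *v v) \<le> e * norm v"
    if "e > 0" for e
  proof -
    have "uniformly_Cauchy_on (cball a (2 * \<rho>)) h"
      using lim uniformly_convergent_Cauchy uniformly_convergent_on_def by blast
    \<comment> \<open>The Cauchy estimate multiplies by \<open>C\<close>, so the tolerance
      \<open>e / C\<close> leaves exactly \<open>e\<close>.\<close>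
    then obtain N where N: "\<And>m n z. m \<ge> N \<Longrightarrow> n \<ge> N \<Longrightarrow> z \<in> cball a (2 * \<rho>)
        \<Longrightarrow> dist (h m z) (h n z) < e / C"
      using divide_pos_pos[OF \<open>e > 0\<close> \<open>C > 0\<close>] unfolding uniformly_Cauchy_on_def by blast
    have "norm ((J m x - J n x) *v v) \<le> e * norm v"
      if "m \<ge> N" "n \<ge> N" "x \<in> cball a \<rho>" for m n x v
    proof -
      have "norm ((J m x - J n x) *v v) \<le> real CARD('m) * (e / C) / \<rho> * norm v"
        unfolding J_diff[OF x\<Omega>[OF that(3)]]
      proof (rule cauchy_estimate_ball[OF holomorphic_map_on_diff[OF hol hol] \<open>0 < \<rho>\<close> sub _ that(3)])
        show "norm (h m z - h n z) \<le> e / C" if "z \<in> cball a (2 * \<rho>)" for z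
          using N[OF \<open>m \<ge> N\<close> \<open>n \<ge> N\<close> that] by (simp add: dist_norm)
      qed
      also have "real CARD('m) * (e / C) / \<rho> = e"
        using \<open>0 < \<rho>\<close> by (simp add: C_def)
      finally show ?thesis .
    qed
    then show ?thesis
      by blast
  qed
  define G where "G x = (\<chi> i j. lim (\<lambda>n. J n x $ i $ j))" for x
  have J_lim: "(\<lambda>n. J n x *v v) \<longlonglongrightarrow> G x *v v" if x: "x \<in> cball a \<rho>" for x v
  proof -
    have "(\<lambda>n. J n x $ i $ j) \<longlonglongrightarrow> G x $ i $ j" for i j
    proof -
      have "Cauchy (\<lambda>n. J n x $ i $ j)"
      proof (rule metric_CauchyI)
        fix e :: real assume "0 < e"
        \<comment> \<open>Applied to a basis vector of norm 1, the bound controls a single matrix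
          entry; halving \<open>e\<close> makes the estimate strict.\<close>
        then obtain N where N: "\<And>m n v. m \<ge> N \<Longrightarrow> n \<ge> N \<Longrightarrow> norm ((J m x - J n x) *v v) \<le> e / 2 * norm v"
          using Cauchy_J[OF half_gt_zero[OF \<open>0 < e\<close>]] x by blast
        have "dist (J m x $ i $ j) (J n x $ i $ j) < e" if "m \<ge> N" "n \<ge> N" for m n
          using N[OF that, of "axis j 1"] \<open>0 < e\<close>
            Finite_Cartesian_Product.norm_nth_le[of "(J m x - J n x) *v axis j 1" i]
          by (simp add: matrix_vector_mult_axis_component dist_norm)
        then show "\<exists>N. \<forall>m\<ge>N. \<forall>n\<ge>N. dist (J m x $ i $ j) (J n x $ i $ j) < e"
          by blast
      qed
      then show ?thesis
        by (simp add: G_def Cauchy_convergent_iff convergent_LIMSEQ_iff)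
    qed
    then have "(\<lambda>n. (J n x *v v) $ i) \<longlonglongrightarrow> (G x *v v) $ i" for i
      unfolding matrix_vector_mult_def vec_lambda_beta by (intro tendsto_sum tendsto_mult tendsto_const)
    then show ?thesis
      by (rule vec_tendstoI)
  qed
  have "\<exists>g'. \<forall>x\<in>cball a \<rho>. (\<lambda>n. h n x) \<longlonglongrightarrow> g' x \<and>
      (g' has_derivative (\<lambda>v. G x *v v)) (at x within cball a \<rho>)"
  proof (rule has_derivative_sequence[where f' = "\<lambda>n x v. J n x *v v" and f = h
        and g' = "\<lambda>x v. G x *v v" and ?x0.0 = a and l = "g a"])
    show "(h n has_derivative (\<lambda>v. J n x *v v)) (at x within cball a \<rho>)" if "x \<in> cball a \<rho>" for n x
      unfolding J_def
      by (rule has_derivative_at_withinI[OF holomorphic_map_on_jacobian[OF hol x\<Omega>[OF that]]])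
    show "\<forall>\<^sub>F n in sequentially. \<forall>x\<in>cball a \<rho>. \<forall>v. norm (J n x *v v - G x *v v) \<le> e * norm v"
      if "e > 0" for e
    proof -
      obtain N where N: "\<And>m n x v. m \<ge> N \<Longrightarrow> n \<ge> N \<Longrightarrow> x \<in> cball a \<rho>
          \<Longrightarrow> norm ((J m x - J n x) *v v) \<le> e * norm v"
        using Cauchy_J[OF \<open>e > 0\<close>] by blast
      \<comment> \<open>Letting \<open>m\<close> tend to infinity in the Cauchy bound keeps the
        non-strict inequality.\<close>
      have "norm (J n x *v v - G x *v v) \<le> e * norm v" if "n \<ge> N" "x \<in> cball a \<rho>" for n x v
      proof (rule tendsto_upperbound)
        show "(\<lambda>m. norm (J n x *v v - J m x *v v)) \<longlonglongrightarrow> norm (J n x *v v - G x *v v)"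
          by (intro tendsto_intros J_lim that)
        show "\<forall>\<^sub>F m in sequentially. norm (J n x *v v - J m x *v v) \<le> e * norm v"
          unfolding eventually_sequentially matrix_vector_mult_diff_rdistrib[symmetric]
          using N[OF that(1) _ that(2)] by blast
      qed simp
      then show ?thesis
        unfolding eventually_sequentially by blast
    qed
    show "(\<lambda>n. h n a) \<longlonglongrightarrow> g a"
      using tendsto_uniform_limitI[OF lim] \<open>0 < \<rho>\<close> by simp
  qed (use \<open>0 < \<rho>\<close> in auto)
  then obtain g' where g': "\<And>x. x \<in> cball a \<rho> \<Longrightarrow> (\<lambda>n. h n x) \<longlonglongrightarrow> g' x"
      "\<And>x. x \<in> cball a \<rho> \<Longrightarrow> (g' has_derivative (\<lambda>v. G x *v v)) (at x within cball a \<rho>)"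
    by blast
  \<comment> \<open>The limit function \<open>g'\<close> agrees with \<open>g\<close> by uniqueness
    of limits, and on the open ball the derivative within the closed ball is a full
    derivative.\<close>
  have "(g has_derivative (\<lambda>v. G x *v v)) (at x)" if x: "x \<in> ball a \<rho>" for x
  proof (rule has_derivative_transform_within_open)
    show "(g' has_derivative (\<lambda>v. G x *v v)) (at x)"
    proof -
      have "x \<in> cball a \<rho>"
        using x by simp
      from has_derivative_subset[OF g'(2)[OF this] ball_subset_cball] show ?thesis
        by (simp only: at_within_open[OF x open_ball])
    qed
    fix y assume y: "y \<in> ball a \<rho>"
    then have "y \<in> cball a (2 * \<rho>)"
      using \<open>0 < \<rho>\<close> by auto
    then show "g' y = g y"
      using LIMSEQ_unique[OF g'(1)[of y] tendsto_uniform_limitI[OF lim, of y]] y by auto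
  qed (use x in auto)
  then show ?thesis
    by (rule holomorphic_map_onI)
qed

section \<open>Normality from local bounds\<close>

lemma pointwise_bounded_convergent_subsequence:
  fixes f :: "nat \<Rightarrow> 'a \<Rightarrow> 'b::{real_normed_vector,heine_borel}"
  assumes "countable S" and M: "\<And>n x. x \<in> S \<Longrightarrow> norm (f n x) \<le> M x"
  obtains k :: "nat \<Rightarrow> nat" where "strict_mono k" "\<And>x. x \<in> S \<Longrightarrow> convergent (\<lambda>n. f (k n) x)"
proof -
  have pos: "1 + \<bar>M x\<bar> > 0" for x
    by (simp add: add_pos_nonneg)
  \<comment> \<open>The diagonal argument uses one bound for all points. Scaling the values at
    \<open>x\<close> by a positive constant depending on \<open>x\<close> alone provides it, and can
    be undone after passing to the subsequence.\<close>
  define F where "F n x = inverse (1 + \<bar>M x\<bar>) *\<^sub>R f n x" for n x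
  have F: "norm (F n x) \<le> 1" if "x \<in> S" for n x
    using M[OF that, of n] pos[of x] by (simp add: F_def divide_simps)
  obtain k :: "nat \<Rightarrow> nat" where "strict_mono k"
    and k: "\<And>x. x \<in> S \<Longrightarrow> \<exists>l. (\<lambda>n. F (k n) x) \<longlonglongrightarrow> l"
    by (rule function_convergent_subsequence[OF \<open>countable S\<close>, of F 1, OF F]; (assumption | rule that))
  have "convergent (\<lambda>n. f (k n) x)" if x: "x \<in> S" for x
  proof -
    obtain l where "(\<lambda>n. inverse (1 + \<bar>M x\<bar>) *\<^sub>R f (k n) x) \<longlonglongrightarrow> l"
      using k[OF x] unfolding F_def by (elim exE)
    from tendsto_scaleR[OF tendsto_const this, of "1 + \<bar>M x\<bar>"] show ?thesis
      using pos[of x] by (auto simp: convergent_def)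
  qed
  with \<open>strict_mono k\<close> show ?thesis
    by (rule that)
qed

text \<open>A diagonal subsequence converges on a countable dense set. The common local Lipschitz
  constants spread this to uniform convergence on small balls, and finitely many such balls cover a
  compact set.\<close>

theorem montel_several_variables:
  fixes f :: "nat \<Rightarrow> complex ^ 'n \<Rightarrow> complex ^ 'm"
  assumes "open \<Omega>" and hol: "\<And>n. holomorphic_map_on (f n) \<Omega>"
    and bound: "\<And>K. compact K \<Longrightarrow> K \<subseteq> \<Omega> \<Longrightarrow> \<exists>M. \<forall>n. \<forall>z\<in>K. norm (f n z) \<le> M"
  shows "\<exists>r g. strict_mono r \<and> holomorphic_map_on g \<Omega> \<and>
    (\<forall>K. compact K \<and> K \<subseteq> \<Omega> \<longrightarrow> uniform_limit K (f \<circ> r) g sequentially)"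
proof -
  obtain D :: "(complex ^ 'n) set" where "countable D"
    and dense: "\<And>X. open X \<Longrightarrow> X \<noteq> {} \<Longrightarrow> \<exists>d\<in>D. d \<in> X"
    using countable_dense_setE by blast
  have "\<exists>M. \<forall>n. norm (f n z) \<le> M" if "z \<in> \<Omega>" for z
    using bound[of "{z}"] that by auto
  then obtain M where M: "\<And>n z. z \<in> \<Omega> \<Longrightarrow> norm (f n z) \<le> M z"
    by metis
  have D\<Omega>: "countable (D \<inter> \<Omega>)" "\<And>n x. x \<in> D \<inter> \<Omega> \<Longrightarrow> norm (f n x) \<le> M x"
    using \<open>countable D\<close> M by simp_all
  obtain k :: "nat \<Rightarrow> nat" where "strict_mono k"
    and k: "\<And>x. x \<in> D \<inter> \<Omega> \<Longrightarrow> convergent (\<lambda>n. f (k n) x)"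
    by (rule pointwise_bounded_convergent_subsequence[OF D\<Omega>]; (assumption | rule that))
  define h where "h = f \<circ> k"
  \<comment> \<open>Three radii are in play: the sequence is bounded on 2\<rho>, Lipschitz on
    \<rho>, and Cauchy on \<rho>/2. The last gap leaves room for nearby points of
    \<open>D\<close>.\<close>
  have Cauchy_ball: "uniformly_Cauchy_on (cball a (\<rho> / 2)) h"
    if "0 < \<rho>" and sub: "cball a (2 * \<rho>) \<subseteq> \<Omega>" for a \<rho>
  proof (unfold uniformly_Cauchy_on_def, intro allI impI)
    fix e :: real assume "e > 0"
    obtain B where B: "\<And>n z. z \<in> cball a (2 * \<rho>) \<Longrightarrow> norm (f n z) \<le> B"
      using bound[OF compact_cball sub] by blast
    define L where "L = real CARD('m) * B / \<rho>"
    have "0 \<le> B"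
      using order_trans[OF norm_ge_zero B[of a 0]] \<open>0 < \<rho>\<close> by simp
    then have "0 \<le> L"
      using \<open>0 < \<rho>\<close> by (simp add: L_def)
    have Lip: "norm (h n x - h n y) \<le> L * norm (x - y)" if "x \<in> cball a \<rho>" "y \<in> cball a \<rho>" for n x y
      unfolding L_def h_def comp_def
      by (rule holomorphic_map_on_lipschitz_ball[OF hol \<open>0 < \<rho>\<close> sub B that])
    \<comment> \<open>The first term keeps the chosen points of \<open>D\<close> within radius
      \<rho>; the second makes the Lipschitz error at most \<open>e / 3\<close>. Using
      \<open>L + 1\<close> avoids dividing by zero.\<close>
    define \<delta> where "\<delta> = min (\<rho> / 2) (e / (3 * (L + 1)))"
    have "\<delta> > 0"
      using \<open>0 < \<rho>\<close> \<open>0 < e\<close> \<open>0 \<le> L\<close> by (simp add: \<delta>_def)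
    have L\<delta>: "L * \<delta> \<le> e / 3"
    proof -
      have "L * \<delta> \<le> (L + 1) * (e / (3 * (L + 1)))"
        using \<open>0 \<le> L\<close> \<open>\<delta> > 0\<close> by (intro mult_mono) (auto simp: \<delta>_def)
      also have "\<dots> = e / 3"
        using \<open>0 \<le> L\<close> by (simp add: divide_simps)
      finally show ?thesis .
    qed
    have "cball a (\<rho> / 2) \<subseteq> (\<Union>d\<in>D \<inter> cball a \<rho>. ball d \<delta>)"
    proof
      fix x assume x: "x \<in> cball a (\<rho> / 2)"
      obtain d where d: "d \<in> D" "d \<in> ball x \<delta>"
        using dense[of "ball x \<delta>"] \<open>\<delta> > 0\<close> by auto
      have "d \<in> cball a \<rho>"
        using d(2) x dist_triangle[of a d x] by (simp add: \<delta>_def)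
      with d show "x \<in> (\<Union>d\<in>D \<inter> cball a \<rho>. ball d \<delta>)"
        by (auto simp: dist_commute)
    qed
    from compactE_image[OF compact_cball open_ball this]
    obtain D' where D': "D' \<subseteq> D \<inter> cball a \<rho>" "finite D'"
        "cball a (\<rho> / 2) \<subseteq> (\<Union>d\<in>D'. ball d \<delta>)"
      by blast
    have "\<exists>N. \<forall>m\<ge>N. \<forall>n\<ge>N. dist (h m d) (h n d) < e / 3" if "d \<in> D'" for d
    proof -
      have "d \<in> D \<inter> \<Omega>"
        using that D'(1) sub \<open>0 < \<rho>\<close> by (force simp: subset_iff)
      then have "Cauchy (\<lambda>n. h n d)"
        using k by (simp add: h_def convergent_Cauchy)
      then show ?thesis
        using metric_CauchyD[of "\<lambda>n. h n d" "e / 3"] \<open>e > 0\<close> by simp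
    qed
    then obtain N where N: "\<And>d m n. d \<in> D' \<Longrightarrow> m \<ge> N d \<Longrightarrow> n \<ge> N d \<Longrightarrow> dist (h m d) (h n d) < e / 3"
      by metis
    have "dist (h m x) (h n x) < e"
      if x: "x \<in> cball a (\<rho> / 2)" and mn: "m \<ge> Max (N ` D')" "n \<ge> Max (N ` D')" for x m n
    proof -
      obtain d where d: "d \<in> D'" "dist x d < \<delta>"
        using D'(3) x by (auto simp: dist_commute)
      have "N d \<le> Max (N ` D')"
        using d(1) D'(2) by simp
      then have 1: "dist (h m d) (h n d) < e / 3"
        using N[OF d(1)] mn by simp
      have xd: "x \<in> cball a \<rho>" "d \<in> cball a \<rho>"
        using x d(1) D'(1) \<open>0 < \<rho>\<close> by auto
      have "L * dist x d \<le> e / 3"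
        using L\<delta> mult_left_mono[of "dist x d" \<delta> L] d(2) \<open>0 \<le> L\<close> by simp
      then have 2: "dist (h i x) (h i d) \<le> e / 3" for i
        using Lip[OF xd, of i] by (simp add: dist_norm[symmetric])
      show ?thesis
        using 1 2[of m] 2[of n] dist_triangle[of "h m x" "h n x" "h m d"]
          dist_triangle[of "h m d" "h n x" "h n d"] dist_commute[of "h n d" "h n x"]
        by linarith
    qed
    then show "\<exists>N. \<forall>x\<in>cball a (\<rho> / 2). \<forall>m\<ge>N. \<forall>n\<ge>N. dist (h m x) (h n x) < e"
      by blast
  qed
  \<comment> \<open>One pointwise limit serves all balls, so no gluing of local limits is
    required.\<close>
  define g where "g z = lim (\<lambda>n. h n z)" for z
  have lim_ball: "uniform_limit (cball a (\<rho> / 2)) h g sequentially"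
    if "0 < \<rho>" and sub: "cball a (2 * \<rho>) \<subseteq> \<Omega>" for a \<rho>
    using Cauchy_uniformly_convergent[OF Cauchy_ball[OF that]]
    unfolding uniformly_convergent_uniform_limit_iff g_def .
  have nbhd: "\<exists>\<rho>>0. cball a (2 * \<rho>) \<subseteq> \<Omega>" if a: "a \<in> \<Omega>" for a
  proof -
    obtain e where "e > 0" "cball a e \<subseteq> \<Omega>"
      using open_contains_cball[THEN iffD1, OF \<open>open \<Omega>\<close>] a by blast
    then show ?thesis
      by (intro exI[of _ "e / 2"]) auto
  qed
  have "holomorphic_map_on g \<Omega>"
  proof (rule holomorphic_map_onI)
    fix a assume "a \<in> \<Omega>"
    then obtain \<rho> where \<rho>: "\<rho> > 0" "cball a (2 * \<rho>) \<subseteq> \<Omega>"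
      using nbhd by blast
    \<comment> \<open>Uniform convergence is available on radius \<rho>/2, and the limit lemma
      yields holomorphy on half of that radius.\<close>
    have "cball a (2 * (\<rho> / 4)) \<subseteq> \<Omega>"
      using \<rho> subset_cball[of "2 * (\<rho> / 4)" "2 * \<rho>" a] by auto
    then have "holomorphic_map_on g (ball a (\<rho> / 4))"
      using lim_ball[OF \<rho>] \<rho>(1) hol
      by (intro holomorphic_map_on_ball_uniform_limit[of h \<Omega>]) (auto simp: h_def)
    from holomorphic_map_on_jacobian[OF this, of a] \<rho>(1)
    show "(g has_derivative (\<lambda>h. jacobian g (at a) *v h)) (at a)"
      by simp
  qed
  moreover have "uniform_limit K h g sequentially" if "compact K" "K \<subseteq> \<Omega>" for K
  proof -
    obtain \<rho> where \<rho>: "\<And>a. a \<in> \<Omega> \<Longrightarrow> \<rho> a > 0 \<and> cball a (2 * \<rho> a) \<subseteq> \<Omega>"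
      using nbhd by metis
    have "K \<subseteq> (\<Union>a\<in>K. ball a (\<rho> a / 2))"
      using \<rho> that(2) by force
    from compactE_image[OF \<open>compact K\<close> open_ball this]
    obtain K' where K': "K' \<subseteq> K" "finite K'" "K \<subseteq> (\<Union>a\<in>K'. ball a (\<rho> a / 2))"
      by blast
    have "uniform_limit (\<Union>a\<in>K'. cball a (\<rho> a / 2)) h g sequentially"
      using K'(1,2) \<rho> that(2) lim_ball by (intro uniform_limit_on_UNION) auto
    then show ?thesis
      by (rule uniform_limit_on_subset) (use K'(3) in force)
  qed
  ultimately show ?thesis
    using \<open>strict_mono k\<close> unfolding h_def by (intro exI[of _ k] exI[of _ g]) simp
qed

section \<open>Curves and invariance\<close>

lemma jacobian_left_inverse:
  fixes f :: "complex ^ 'n \<Rightarrow> complex ^ 'm" and g :: "complex ^ 'm \<Rightarrow> complex ^ 'n"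
  assumes "open \<Omega>" "z \<in> \<Omega>" and f: "holomorphic_map_on f \<Omega>" and g: "holomorphic_map_on g (f ` \<Omega>)"
    and inv: "\<And>w. w \<in> \<Omega> \<Longrightarrow> g (f w) = w"
  shows "jacobian g (at (f z)) ** jacobian f (at z) = mat 1"
proof -
  have "((\<lambda>w. g (f w)) has_derivative
      (\<lambda>h. jacobian g (at (f z)) *v (jacobian f (at z) *v h))) (at z)"
    by (rule has_derivative_compose[OF holomorphic_map_on_jacobian[OF f \<open>z \<in> \<Omega>\<close>]
          holomorphic_map_on_jacobian[OF g imageI[OF \<open>z \<in> \<Omega>\<close>]]])
  \<comment> \<open>The composite is the identity only on \<Omega>; openness makes this enough to
    determine its derivative at \<open>z\<close>.\<close>
  moreover have "((\<lambda>w. g (f w)) has_derivative (\<lambda>h. h)) (at z)"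
    by (rule has_derivative_transform_within_open[OF has_derivative_ident \<open>open \<Omega>\<close> \<open>z \<in> \<Omega>\<close>])
      (simp add: inv)
  ultimately have "(\<lambda>h. jacobian g (at (f z)) *v (jacobian f (at z) *v h)) = (\<lambda>h. h)"
    by (rule has_derivative_unique)
  then show ?thesis
    by (simp add: matrix_eq matrix_vector_mul_assoc fun_eq_iff)
qed

text \<open>\<open>matrix_inv\<close> is a choice operator: the given \<open>B\<close> shows that
  the choice succeeds, and associativity shows that it can only be \<open>B\<close>.\<close>

lemma matrix_inv_eqI:
  fixes A B :: "'a::semiring_1 ^ 'n ^ 'n"
  assumes "A ** B = mat 1" "B ** A = mat 1"
  shows "matrix_inv A = B"
proof -
  have inv: "A ** matrix_inv A = mat 1 \<and> matrix_inv A ** A = mat 1"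
    unfolding matrix_inv_def by (rule someI[of _ B]) (simp add: assms)
  have "matrix_inv A = matrix_inv A ** (A ** B)"
    by (simp add: assms)
  also have "\<dots> = B"
    unfolding matrix_mul_assoc by (simp add: inv)
  finally show ?thesis .
qed

lemma holomorphic_map_on_affine:
  fixes f :: "complex ^ 'n \<Rightarrow> complex ^ 'm" and A :: "complex ^ 'm ^ 'k"
  assumes "holomorphic_map_on f \<Omega>"
  shows "holomorphic_map_on (\<lambda>z. A *v (f z - b)) \<Omega>"
proof (rule holomorphic_map_onI)
  fix z assume "z \<in> \<Omega>"
  have "((\<lambda>z. f z - b) has_derivative (\<lambda>h. jacobian f (at z) *v h)) (at z)"
    using has_derivative_diff[OF holomorphic_map_on_jacobian[OF assms \<open>z \<in> \<Omega>\<close>] has_derivative_const]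
    by simp
  from bounded_linear.has_derivative[OF matrix_vector_mul_bounded_linear this]
  show "((\<lambda>z. A *v (f z - b)) has_derivative (\<lambda>h. (A ** jacobian f (at z)) *v h)) (at z)"
    by (simp add: matrix_vector_mul_assoc)
qed

section \<open>Lengths of curves\<close>

lemma piecewise_differentiable_on_has_vector_derivative:
  fixes c :: "real \<Rightarrow> 'a::real_normed_vector"
  assumes "c piecewise_differentiable_on {0..1}"
  shows "\<exists>S. finite S \<and> (\<forall>t\<in>{0..1} - S.
    (c has_vector_derivative vector_derivative c (at t)) (at t))"
proof -
  obtain S where "finite S" and S: "\<And>t. t \<in> {0..1} - S \<Longrightarrow> c differentiable (at t within {0..1})"
    using assms unfolding piecewise_differentiable_on_def by blast
  \<comment> \<open>Differentiability is given within \<open>{0..1}\<close>, whereas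
    \<open>finsler_length\<close> uses the two-sided derivative. The two agree once the end points
    join the exceptional set.\<close>
  have "(c has_vector_derivative vector_derivative c (at t)) (at t)"
    if t: "t \<in> {0..1} - insert 0 (insert 1 S)" for t
  proof -
    have "c differentiable (at t)"
      using S[of t] t at_within_Icc_at[of 0 t 1] by auto
    then show ?thesis
      by (simp add: vector_derivative_works)
  qed
  then show ?thesis
    using \<open>finite S\<close> by (intro exI[of _ "insert 0 (insert 1 S)"]) blast
qed

text \<open>A finite set is null, and \<open>nn_integral\<close> is monotone for arbitrary
  integrands, measurable or not.\<close>

lemma finsler_length_mono:
  assumes "finite S"
    and le: "\<And>t. t \<in> {0..1} - S \<Longrightarrow>
      F (c t) (vector_derivative c (at t)) \<le> G (d t) (vector_derivative d (at t))"
  shows "finsler_length F c \<le> finsler_length G d"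
  unfolding finsler_length_def
proof (rule nn_integral_mono_AE)
  have "AE t in lborel. t \<notin> S"
    using finite_imp_null_set_lborel[OF \<open>finite S\<close>] by (rule AE_not_in)
  then show "AE t in lborel. ennreal (F (c t) (vector_derivative c (at t))) * indicator {0..1} t
      \<le> ennreal (G (d t) (vector_derivative d (at t))) * indicator {0..1} t"
    by eventually_elim (use le in \<open>auto simp: indicator_def ennreal_leI\<close>)
qed

text \<open>The segment is the competing curve: its derivative is constantly \<open>y - x\<close>,
  and its parameter interval has length 1.\<close>

lemma finsler_dist_le_segment:
  fixes F :: "complex ^ 'n \<Rightarrow> complex ^ 'n \<Rightarrow> real"
  assumes "\<And>z. z \<in> closed_segment x y \<Longrightarrow> z \<in> \<Omega> \<and> F z (y - x) \<le> C" and "0 \<le> C"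
  shows "finsler_dist \<Omega> F x y \<le> C"
proof -
  have on_seg: "linepath x y t \<in> closed_segment x y" if "t \<in> {0..1}" for t
    using that linepath_in_path by blast
  have "linepath x y differentiable_on {0..1}"
    by (simp add: differentiable_on_def differentiableI_vector[OF has_vector_derivative_linepath_within])
  then have "linepath x y \<in> curves_joining \<Omega> x y"
    using on_seg assms(1)
    by (auto simp: curves_joining_def differentiable_on_imp_piecewise_differentiable
        linepath_0' linepath_1')
  then have "(INF c\<in>curves_joining \<Omega> x y. finsler_length F c) \<le> finsler_length F (linepath x y)"
    by (rule INF_lower)
  also have "\<dots> \<le> (\<integral>\<^sup>+ t. ennreal C * indicator {0..1} t \<partial>(lborel::real measure))"
    unfolding finsler_length_def
  proof (rule nn_integral_mono)
    fix t :: real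
    show "ennreal (F (linepath x y t) (vector_derivative (linepath x y) (at t))) * indicator {0..1} t
        \<le> ennreal C * indicator {0..1} t"
      using assms(1)[OF on_seg, of t] by (auto simp: indicator_def ennreal_leI)
  qed
  also have "\<dots> = ennreal C"
    by (simp add: nn_integral_cmult)
  \<comment> \<open>\<open>enn2real\<close> sends infinity to 0 and is monotone only below a finite
    bound, which \<open>C\<close> supplies.\<close>
  finally have "enn2real (INF c\<in>curves_joining \<Omega> x y. finsler_length F c) \<le> enn2real (ennreal C)"
    by (rule enn2real_mono) simp
  then show ?thesis
    using \<open>0 \<le> C\<close> by (simp add: finsler_dist_def)
qed

lemma finsler_metric_scale:
  assumes "finsler_metric \<Omega> F" "x \<in> \<Omega>"
  shows "F x (c *s v) = cmod c * F x v" "F x (r *\<^sub>R v) = \<bar>r\<bar> * F x v" "F x 0 = 0"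
proof -
  show scale: "F x (c *s v) = cmod c * F x v" for c v
    using assms by (simp add: finsler_metric_def)
  show "F x (r *\<^sub>R v) = \<bar>r\<bar> * F x v"
    by (simp add: scaleR_vector_scalar_mult scale)
  show "F x 0 = 0"
    using scale[of 0 0] by simp
qed

lemma finsler_metric_nonneg: "finsler_metric \<Omega> F \<Longrightarrow> x \<in> \<Omega> \<Longrightarrow> 0 \<le> F x v"
  by (simp add: finsler_metric_def)

text \<open>By homogeneity, upper semicontinuity at the single point \<open>(x, 0)\<close> already yields this bound.\<close>

lemma finsler_metric_locally_bounded:
  fixes F :: "complex ^ 'n \<Rightarrow> complex ^ 'n \<Rightarrow> real"
  assumes "open \<Omega>" and F: "finsler_metric \<Omega> F" and x: "x \<in> \<Omega>"
  shows "\<exists>e>0. \<exists>C>0. ball x e \<subseteq> \<Omega> \<and> (\<forall>z\<in>ball x e. \<forall>v. F z v \<le> C * norm v)"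
proof -
  have "(x, 0) \<in> \<Omega> \<times> (UNIV :: (complex ^ 'n) set)" "(case (x, 0) of (x, v) \<Rightarrow> F x v) < 1"
    using x finsler_metric_scale(3)[OF F x] by auto
  moreover have "upper_semicontinuous_on (\<Omega> \<times> UNIV) (\<lambda>(x, v). F x v)"
    using F by (simp add: finsler_metric_def)
  ultimately have "\<forall>\<^sub>F y in at (x, 0) within \<Omega> \<times> UNIV. (case y of (x, v) \<Rightarrow> F x v) < 1"
    unfolding upper_semicontinuous_on_def by blast
  then obtain e where "e > 0"
    and e: "\<And>z v. z \<in> \<Omega> \<Longrightarrow> (z, v) \<noteq> (x, 0) \<Longrightarrow> dist (z, v) (x, 0) < e \<Longrightarrow> F z v < 1"
    unfolding eventually_at by fastforce
  obtain e' where "e' > 0" and e': "ball x e' \<subseteq> \<Omega>"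
    using open_contains_ball[THEN iffD1, OF \<open>open \<Omega>\<close>] x by blast
  define \<delta> where "\<delta> = min e' (e / 2)"
  have "F z v \<le> 4 / e * norm v" if z: "z \<in> ball x \<delta>" for z v
  proof -
    have "z \<in> \<Omega>"
      using z e' by (auto simp: \<delta>_def)
    show ?thesis
    proof (cases "v = 0")
      case False
      \<comment> \<open>Scaling \<open>v\<close> to norm \<open>e / 4\<close> puts
        \<open>(z, u)\<close> within \<open>e\<close> of \<open>(x, 0)\<close>, as \<open>z\<close>
        is less than \<open>e / 2\<close> away from \<open>x\<close>. Homogeneity then converts
        \<open>F z u < 1\<close> into the bound for \<open>v\<close>.\<close>
      define u where "u = (e / (4 * norm v)) *\<^sub>R v"
      have "norm u = e / 4"
        using False \<open>e > 0\<close> by (simp add: u_def)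
      then have "dist (z, u) (x, 0) < e"
        using z \<open>e > 0\<close> sqrt_sum_squares_le_sum[of "dist z x" "norm u"]
        by (simp add: dist_Pair_Pair \<delta>_def dist_commute)
      moreover have "u \<noteq> 0"
        using \<open>norm u = e / 4\<close> \<open>e > 0\<close> by auto
      ultimately have "F z u < 1"
        using e[OF \<open>z \<in> \<Omega>\<close>] by blast
      moreover have "F z u = e / (4 * norm v) * F z v"
        using finsler_metric_scale(2)[OF F \<open>z \<in> \<Omega>\<close>, of "e / (4 * norm v)" v] \<open>e > 0\<close>
        by (simp add: u_def)
      ultimately show ?thesis
        using False \<open>e > 0\<close> by (simp add: field_simps)
    qed (simp add: finsler_metric_scale(3)[OF F \<open>z \<in> \<Omega>\<close>])
  qed
  moreover have "\<delta> > 0" "ball x \<delta> \<subseteq> \<Omega>"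
    using \<open>e > 0\<close> \<open>e' > 0\<close> e' by (auto simp: \<delta>_def)
  ultimately show ?thesis
    using \<open>e > 0\<close> by (intro exI[of _ \<delta>] exI[of _ "4 / e"] conjI) auto
qed

text \<open>Stopping the curve avoids the reparametrization, hence a change of variables for an integrand
  that is not known to be measurable.\<close>

lemma curves_joining_stopped:
  fixes F :: "complex ^ 'n \<Rightarrow> complex ^ 'n \<Rightarrow> real"
  assumes F: "finsler_metric \<Omega> F" and c: "c \<in> curves_joining \<Omega> x y" and "s \<in> {0..1}"
  shows "(\<lambda>t. c (min t s)) \<in> curves_joining \<Omega> x (c s)"
    and "finsler_length F (\<lambda>t. c (min t s)) \<le> finsler_length F c"
proof -
  have pw: "c piecewise_differentiable_on {0..1}" and c\<Omega>: "\<And>t. t \<in> {0..1} \<Longrightarrow> c t \<in> \<Omega>" and "c 0 = x"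
    using c by (auto simp: curves_joining_def)
  obtain S where "finite S" and S: "\<And>t. t \<in> {0..1} - S \<Longrightarrow>
      (c has_vector_derivative vector_derivative c (at t)) (at t)"
    using piecewise_differentiable_on_has_vector_derivative[OF pw] by blast
  define g where "g t = c (min t s)" for t
  have before: "(g has_vector_derivative vector_derivative c (at t)) (at t)"
    if "t \<in> {0..1} - insert s S" "t < s" for t
    using that
    by (intro has_vector_derivative_transform_within_open[OF S open_lessThan[of s]]) (auto simp: g_def)
  \<comment> \<open>Past \<open>s\<close> the stopped curve is constant and contributes no length;
    \<open>s\<close> itself, a possible corner, is put into the exceptional set.\<close>
  have after: "(g has_vector_derivative 0) (at t)" if "t > s" for t
    using that
    by (intro has_vector_derivative_transform_within_open[OF has_vector_derivative_const
          open_greaterThan[of s]]) (auto simp: g_def)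
  have "continuous_on {0..1} g"
    unfolding g_def
  proof (rule continuous_on_compose2[OF piecewise_differentiable_on_imp_continuous_on[OF pw]])
    show "continuous_on {0..1} (\<lambda>t. min t s)"
      by (intro continuous_intros)
  qed (use \<open>s \<in> {0..1}\<close> in auto)
  moreover have "g differentiable (at t within {0..1})" if "t \<in> {0..1} - insert s S" for t
  proof (rule differentiable_at_withinI, cases "t < s")
    case True
    then show "g differentiable (at t)"
      by (rule differentiableI_vector[OF before[OF that]])
  next
    case False
    then have "s < t"
      using that by auto
    then show "g differentiable (at t)"
      by (rule differentiableI_vector[OF after])
  qed
  ultimately have "g piecewise_differentiable_on {0..1}"
    unfolding piecewise_differentiable_on_def
    using \<open>finite S\<close> by (intro conjI exI[of _ "insert s S"]) auto
  then show "(\<lambda>t. c (min t s)) \<in> curves_joining \<Omega> x (c s)"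
    using \<open>s \<in> {0..1}\<close> c\<Omega> \<open>c 0 = x\<close> by (auto simp: curves_joining_def g_def[abs_def])
  have "finsler_length F g \<le> finsler_length F c"
  proof (rule finsler_length_mono)
    show "F (g t) (vector_derivative g (at t)) \<le> F (c t) (vector_derivative c (at t))"
      if t: "t \<in> {0..1} - insert s S" for t
    proof (cases "t < s")
      case True
      then show ?thesis
        using vector_derivative_at[OF before[OF t True]] by (simp add: g_def)
    next
      case False
      then have "t > s"
        using t by auto
      then show ?thesis
        using vector_derivative_at[OF after[OF \<open>t > s\<close>]] c\<Omega>[of s] c\<Omega>[of t] t \<open>s \<in> {0..1}\<close>
        by (simp add: g_def finsler_metric_scale(3)[OF F] finsler_metric_nonneg[OF F])
    qed
  qed (use \<open>finite S\<close> in simp)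
  then show "finsler_length F (\<lambda>t. c (min t s)) \<le> finsler_length F c"
    by (simp add: g_def[abs_def])
qed

text \<open>By the chain rule and invariance, the two integrands agree off a finite set. The
  hypotheses concern a single map \<open>f\<close>, so that both an automorphism and its inverse can
  be inserted.\<close>

lemma finsler_length_holomorphic_image:
  fixes F :: "complex ^ 'n \<Rightarrow> complex ^ 'n \<Rightarrow> real"
  assumes hol: "holomorphic_map_on f \<Omega>" and "f ` \<Omega> \<subseteq> \<Omega>"
    and inv: "\<And>z v. z \<in> \<Omega> \<Longrightarrow> F (f z) (jacobian f (at z) *v v) = F z v"
    and c: "c \<in> curves_joining \<Omega> x y"
  shows "f \<circ> c \<in> curves_joining \<Omega> (f x) (f y)" "finsler_length F (f \<circ> c) \<le> finsler_length F c"
proof -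
  have pw: "c piecewise_differentiable_on {0..1}" and c\<Omega>: "\<And>t. t \<in> {0..1} \<Longrightarrow> c t \<in> \<Omega>"
    using c by (auto simp: curves_joining_def)
  obtain S where "finite S" and S: "\<And>t. t \<in> {0..1} - S \<Longrightarrow>
      (c has_vector_derivative vector_derivative c (at t)) (at t)"
    using piecewise_differentiable_on_has_vector_derivative[OF pw] by blast
  have der: "((f \<circ> c) has_vector_derivative
      jacobian f (at (c t)) *v vector_derivative c (at t)) (at t)" if t: "t \<in> {0..1} - S" for t
  proof -
    have "c t \<in> \<Omega>"
      using c\<Omega> t by auto
    have "((\<lambda>t. f (c t)) has_derivative
        (\<lambda>r. jacobian f (at (c t)) *v (r *\<^sub>R vector_derivative c (at t)))) (at t)"
      by (rule has_derivative_compose[OF S[OF t, unfolded has_vector_derivative_def]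
            holomorphic_map_on_jacobian[OF hol \<open>c t \<in> \<Omega>\<close>]])
    then show ?thesis
      by (simp add: has_vector_derivative_def comp_def scaleR_vector_scalar_mult vector_scalar_commute)
  qed
  have "c ` {0..1} \<subseteq> \<Omega>"
    using c\<Omega> by blast
  then have "continuous_on {0..1} (f \<circ> c)"
    by (intro continuous_on_compose piecewise_differentiable_on_imp_continuous_on[OF pw]
        continuous_on_subset[OF holomorphic_map_on_continuous_on[OF hol]])
  moreover have "(f \<circ> c) differentiable (at t within {0..1})" if "t \<in> {0..1} - S" for t
    by (rule differentiable_at_withinI[OF differentiableI_vector[OF der[OF that]]])
  ultimately have "(f \<circ> c) piecewise_differentiable_on {0..1}"
    unfolding piecewise_differentiable_on_def using \<open>finite S\<close> by (intro conjI exI[of _ S]) auto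
  then show "f \<circ> c \<in> curves_joining \<Omega> (f x) (f y)"
    using c \<open>f ` \<Omega> \<subseteq> \<Omega>\<close> by (auto simp: curves_joining_def)
  show "finsler_length F (f \<circ> c) \<le> finsler_length F c"
  proof (rule finsler_length_mono[OF \<open>finite S\<close>])
    show "F ((f \<circ> c) t) (vector_derivative (f \<circ> c) (at t)) \<le> F (c t) (vector_derivative c (at t))"
      if t: "t \<in> {0..1} - S" for t
      using inv[OF c\<Omega>[of t]] t vector_derivative_at[OF der[OF t]] by simp
  qed
qed

section \<open>Automorphisms as isometries of the induced distance\<close>

context
  fixes \<Omega> :: "(complex ^ 'n) set" and F \<phi>
  assumes "open \<Omega>" and inv: "invariant_metric \<Omega> F" and \<phi>: "\<phi> \<in> holomorphic_Aut \<Omega>"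
begin

lemma
  shows holomorphic_Aut_holomorphic: "holomorphic_map_on \<phi> \<Omega>" "holomorphic_map_on (inv_into \<Omega> \<phi>) \<Omega>"
    and holomorphic_Aut_image: "\<phi> ` \<Omega> = \<Omega>" "inv_into \<Omega> \<phi> ` \<Omega> = \<Omega>"
    and holomorphic_Aut_inverse: "\<And>z. z \<in> \<Omega> \<Longrightarrow> inv_into \<Omega> \<phi> (\<phi> z) = z"
      "\<And>z. z \<in> \<Omega> \<Longrightarrow> \<phi> (inv_into \<Omega> \<phi> z) = z"
proof -
  have bij: "bij_betw \<phi> \<Omega> \<Omega>"
    using \<phi> by (simp add: holomorphic_Aut_def)
  show "\<phi> ` \<Omega> = \<Omega>" "inv_into \<Omega> \<phi> ` \<Omega> = \<Omega>"
    using bij bij_betw_inv_into[OF bij] by (simp_all add: bij_betw_def)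
  show "\<And>z. z \<in> \<Omega> \<Longrightarrow> inv_into \<Omega> \<phi> (\<phi> z) = z" "\<And>z. z \<in> \<Omega> \<Longrightarrow> \<phi> (inv_into \<Omega> \<phi> z) = z"
    using bij by (simp_all add: bij_betw_inv_into_left bij_betw_inv_into_right)
  show "holomorphic_map_on \<phi> \<Omega>" "holomorphic_map_on (inv_into \<Omega> \<phi>) \<Omega>"
    using \<phi> by (simp_all add: holomorphic_Aut_def)
qed

lemma jacobian_inv_into:
  assumes "z \<in> \<Omega>"
  shows "jacobian (inv_into \<Omega> \<phi>) (at (\<phi> z)) ** jacobian \<phi> (at z) = mat 1"
    and "jacobian \<phi> (at z) ** jacobian (inv_into \<Omega> \<phi>) (at (\<phi> z)) = mat 1"
proof -
  show "jacobian (inv_into \<Omega> \<phi>) (at (\<phi> z)) ** jacobian \<phi> (at z) = mat 1"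
    using \<open>open \<Omega>\<close> assms holomorphic_Aut_holomorphic holomorphic_Aut_image holomorphic_Aut_inverse
    by (intro jacobian_left_inverse[of \<Omega>]) simp_all
  have "\<phi> z \<in> \<Omega>"
    using assms holomorphic_Aut_image by blast
  then have "jacobian \<phi> (at (inv_into \<Omega> \<phi> (\<phi> z))) ** jacobian (inv_into \<Omega> \<phi>) (at (\<phi> z)) = mat 1"
    using \<open>open \<Omega>\<close> holomorphic_Aut_holomorphic holomorphic_Aut_image holomorphic_Aut_inverse
    by (intro jacobian_left_inverse[of \<Omega>]) simp_all
  then show "jacobian \<phi> (at z) ** jacobian (inv_into \<Omega> \<phi>) (at (\<phi> z)) = mat 1"
    by (simp add: holomorphic_Aut_inverse assms)
qed

text \<open>Invariance under \<phi> is read backwards at the preimage of \<open>z\<close>, where the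
  two Jacobians cancel. Thus membership of the inverse in \<open>holomorphic_Aut\<close> need not be
  shown.\<close>

lemma invariant_metric_inv_into:
  assumes "z \<in> \<Omega>"
  shows "F (inv_into \<Omega> \<phi> z) (jacobian (inv_into \<Omega> \<phi>) (at z) *v v) = F z v"
proof -
  define w where "w = inv_into \<Omega> \<phi> z"
  have w: "w \<in> \<Omega>" "\<phi> w = z"
    using assms holomorphic_Aut_image(2) holomorphic_Aut_inverse(2) by (auto simp: w_def)
  have "F w u = F z (jacobian \<phi> (at w) *v u)" for u
    using inv \<phi> w unfolding invariant_metric_def by metis
  then show ?thesis
    using jacobian_inv_into(2)[OF w(1)] w(2) by (simp add: w_def[symmetric] matrix_vector_mul_assoc)
qed

text \<open>Neither \<phi> nor its inverse increases lengths. The infima are compared as extended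
  reals, before \<open>enn2real\<close> is applied.\<close>

lemma finsler_dist_holomorphic_Aut:
  assumes "x \<in> \<Omega>" "y \<in> \<Omega>"
  shows "finsler_dist \<Omega> F (\<phi> x) (\<phi> y) = finsler_dist \<Omega> F x y"
proof -
  let ?L = "\<lambda>x y. INF c\<in>curves_joining \<Omega> x y. finsler_length F c"
  have "?L (\<phi> x) (\<phi> y) \<le> ?L x y"
  proof (rule INF_greatest)
    fix c assume "c \<in> curves_joining \<Omega> x y"
    then have *: "\<phi> \<circ> c \<in> curves_joining \<Omega> (\<phi> x) (\<phi> y)" "finsler_length F (\<phi> \<circ> c) \<le> finsler_length F c"
      using inv \<phi> holomorphic_Aut_holomorphic(1) holomorphic_Aut_image(1)
      by (auto simp: invariant_metric_def intro!: finsler_length_holomorphic_image)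
    show "?L (\<phi> x) (\<phi> y) \<le> finsler_length F c"
      using INF_lower[OF *(1)] *(2) by (rule order_trans)
  qed
  moreover have "?L x y \<le> ?L (\<phi> x) (\<phi> y)"
  proof (rule INF_greatest)
    let ?\<psi> = "inv_into \<Omega> \<phi>"
    fix c assume "c \<in> curves_joining \<Omega> (\<phi> x) (\<phi> y)"
    from finsler_length_holomorphic_image[where F = F, OF holomorphic_Aut_holomorphic(2)
        equalityD1[OF holomorphic_Aut_image(2)] invariant_metric_inv_into this]
    have *: "?\<psi> \<circ> c \<in> curves_joining \<Omega> x y" "finsler_length F (?\<psi> \<circ> c) \<le> finsler_length F c"
      by (simp_all add: holomorphic_Aut_inverse assms)
    show "?L x y \<le> finsler_length F c"
      using INF_lower[OF *(1)] *(2) by (rule order_trans)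
  qed
  ultimately have "?L (\<phi> x) (\<phi> y) = ?L x y"
    by (rule antisym)
  then show ?thesis
    by (simp add: finsler_dist_def)
qed

end

section \<open>The induced distance\<close>

locale finsler_domain = Metric_space \<Omega> "finsler_dist \<Omega> F"
  for \<Omega> :: "(complex ^ 'n) set" and F :: "complex ^ 'n \<Rightarrow> complex ^ 'n \<Rightarrow> real" +
  assumes open_domain: "open \<Omega>" and finsler: "finsler_metric \<Omega> F"
begin

abbreviation dist\<^sub>F :: "complex ^ 'n \<Rightarrow> complex ^ 'n \<Rightarrow> real"
  where "dist\<^sub>F \<equiv> finsler_dist \<Omega> F"

text \<open>Balls are convex, so segments are admissible curves, and the local bound
  \<open>F z v \<le> C * norm v\<close> controls their length.\<close>

lemma dist_le_norm:
  assumes "x \<in> \<Omega>"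
  shows "\<exists>e>0. \<exists>C>0. ball x e \<subseteq> \<Omega> \<and>
    (\<forall>y\<in>ball x e. \<forall>z\<in>ball x e. dist\<^sub>F y z \<le> C * norm (z - y))"
proof -
  obtain e C where "e > 0" "C > 0" and sub: "ball x e \<subseteq> \<Omega>"
    and C: "\<And>z v. z \<in> ball x e \<Longrightarrow> F z v \<le> C * norm v"
    using finsler_metric_locally_bounded[OF open_domain finsler assms] by blast
  have "dist\<^sub>F y z \<le> C * norm (z - y)" if "y \<in> ball x e" "z \<in> ball x e" for y z
  proof (rule finsler_dist_le_segment)
    fix w assume "w \<in> closed_segment y z"
    then have "w \<in> ball x e"
      using closed_segment_subset[OF that convex_ball] by blast
    then show "w \<in> \<Omega> \<and> F w (z - y) \<le> C * norm (z - y)"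
      using sub C by blast
  qed (use \<open>C > 0\<close> in simp)
  then show ?thesis
    using \<open>e > 0\<close> \<open>C > 0\<close> sub by (intro exI[of _ e] exI[of _ C] conjI ballI) auto
qed

lemma continuous_on_dist_finsler:
  assumes "x \<in> \<Omega>"
  shows "continuous_on \<Omega> (dist\<^sub>F x)"
  unfolding continuous_on_iff
proof (intro ballI allI impI)
  fix y and \<epsilon> :: real assume "y \<in> \<Omega>" "\<epsilon> > 0"
  obtain e C where "e > 0" "C > 0" and sub: "ball y e \<subseteq> \<Omega>"
    and C: "\<And>z w. z \<in> ball y e \<Longrightarrow> w \<in> ball y e \<Longrightarrow> dist\<^sub>F z w \<le> C * norm (w - z)"
    using dist_le_norm[OF \<open>y \<in> \<Omega>\<close>] by blast
  have "dist (dist\<^sub>F x z) (dist\<^sub>F x y) < \<epsilon>" if "z \<in> \<Omega>" "dist z y < min e (\<epsilon> / C)" for z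
  proof -
    have "dist\<^sub>F y z \<le> C * norm (z - y)"
      using C[of y z] that \<open>e > 0\<close> by (simp add: dist_commute)
    also have "\<dots> < \<epsilon>"
      using that(2) \<open>C > 0\<close> by (simp add: dist_norm pos_less_divide_eq mult.commute)
    finally have "dist\<^sub>F y z < \<epsilon>" .
    moreover have "dist\<^sub>F x z \<le> dist\<^sub>F x y + dist\<^sub>F y z" "dist\<^sub>F x y \<le> dist\<^sub>F x z + dist\<^sub>F y z"
      using triangle[OF assms \<open>y \<in> \<Omega>\<close> \<open>z \<in> \<Omega>\<close>] triangle'[OF assms \<open>z \<in> \<Omega>\<close> \<open>y \<in> \<Omega>\<close>] by simp_all
    ultimately show ?thesis
      by (simp add: dist_real_def)
  qed
  then show "\<exists>d>0. \<forall>z\<in>\<Omega>. dist z y < d \<longrightarrow> dist (dist\<^sub>F x z) (dist\<^sub>F x y) < \<epsilon>"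
    using \<open>e > 0\<close> \<open>C > 0\<close> \<open>\<epsilon> > 0\<close> by (intro exI[of _ "min e (\<epsilon> / C)"]) simp
qed

text \<open>A short curve cannot cross a small Euclidean sphere around \<open>x\<close>, on which the distance from
  \<open>x\<close> has a positive minimum. Together with the continuity above: both topologies coincide.\<close>

lemma finsler_ball_within_ball:
  assumes x: "x \<in> \<Omega>" and "e > 0"
  shows "\<exists>\<delta>>0. \<forall>y\<in>\<Omega>. dist\<^sub>F x y < \<delta> \<longrightarrow> norm (y - x) < e"
proof -
  obtain e' where "e' > 0" and e': "cball x e' \<subseteq> \<Omega>"
    using open_contains_cball[THEN iffD1, OF open_domain] x by blast
  \<comment> \<open>The sphere of this radius lies in \<Omega> and separates \<open>x\<close> from
    every point at distance at least \<open>e\<close>.\<close>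
  define \<rho> where "\<rho> = min e e'"
  have "\<rho> > 0" and sphere: "sphere x \<rho> \<subseteq> \<Omega>"
    using \<open>e > 0\<close> \<open>e' > 0\<close> e' by (auto simp: \<rho>_def)
  have "sphere x \<rho> \<noteq> {}"
    using vector_choose_dist[of \<rho> x] \<open>\<rho> > 0\<close> by auto
  then obtain s0 where s0: "s0 \<in> sphere x \<rho>" and min: "\<And>s. s \<in> sphere x \<rho> \<Longrightarrow> dist\<^sub>F x s0 \<le> dist\<^sub>F x s"
    using continuous_attains_inf[OF compact_sphere _
        continuous_on_subset[OF continuous_on_dist_finsler[OF x] sphere]] by blast
  define \<delta> where "\<delta> = dist\<^sub>F x s0"
  have "\<delta> > 0"
    using s0 sphere x \<open>\<rho> > 0\<close> by (auto simp: \<delta>_def intro!: mdist_pos_less)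
  have "norm (y - x) < e" if y: "y \<in> \<Omega>" "dist\<^sub>F x y < \<delta>" for y
  proof (rule ccontr)
    assume "\<not> norm (y - x) < e"
    then have far: "\<rho> \<le> dist x y"
      by (simp add: \<rho>_def dist_norm norm_minus_commute)
    let ?L = "\<lambda>y. INF c\<in>curves_joining \<Omega> x y. finsler_length F c"
    have "ennreal \<delta> \<le> ?L y"
    proof (rule INF_greatest)
      fix c assume c: "c \<in> curves_joining \<Omega> x y"
      then have c01: "c 0 = x" "c 1 = y" and cont: "continuous_on {0..1} c"
        using piecewise_differentiable_on_imp_continuous_on by (auto simp: curves_joining_def)
      have "continuous_on {0..1} (\<lambda>t. dist x (c t))"
        by (intro continuous_intros cont)
      \<comment> \<open>The curve crosses the sphere, by the intermediate value theorem applied to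
        the distance from \<open>x\<close>.\<close>
      then obtain s where s: "s \<in> {0..1}" "dist x (c s) = \<rho>"
        using IVT'[of "\<lambda>t. dist x (c t)" 0 \<rho> 1] far \<open>\<rho> > 0\<close> c01 by auto
      then have "c s \<in> sphere x \<rho>"
        by simp
      then have "\<delta> \<le> enn2real (?L (c s))"
        using min by (simp add: \<delta>_def finsler_dist_def)
      then have "ennreal \<delta> \<le> ennreal (enn2real (?L (c s)))"
        by (rule ennreal_leI)
      \<comment> \<open>Since \<open>enn2real\<close> of infinity is 0, a positive value certifies
        that the infimum is finite and may be recovered from its real part.\<close>
      also have "?L (c s) < top"
        using less_le_trans[OF \<open>\<delta> > 0\<close> \<open>\<delta> \<le> enn2real (?L (c s))\<close>] enn2real_positive_iff by blast
      then have "ennreal (enn2real (?L (c s))) = ?L (c s)"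
        by simp
      also have "?L (c s) \<le> finsler_length F (\<lambda>t. c (min t s))"
        by (rule INF_lower[OF curves_joining_stopped(1)[OF finsler c s(1)]])
      also have "\<dots> \<le> finsler_length F c"
        by (rule curves_joining_stopped(2)[OF finsler c s(1)])
      finally show "ennreal \<delta> \<le> finsler_length F c" .
    qed
    \<comment> \<open>Positivity again excludes infinity; here it comes from the separation of
      distinct points in a metric space.\<close>
    moreover have "?L y < top"
    proof -
      have "0 < dist\<^sub>F x y"
        using x y(1) far \<open>\<rho> > 0\<close> by (intro mdist_pos_less) auto
      then show ?thesis
        unfolding finsler_dist_def enn2real_positive_iff by (rule conjunct2)
    qed
    ultimately have "enn2real (ennreal \<delta>) \<le> dist\<^sub>F x y"
      unfolding finsler_dist_def by (rule enn2real_mono)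
    with y(2) \<open>\<delta> > 0\<close> show False
      by simp
  qed
  with \<open>\<delta> > 0\<close> show ?thesis
    by blast
qed

text \<open>Completeness rules out that the segment leaves the domain: at a first exit parameter its
  points form a Cauchy sequence.\<close>

lemma segment_within_finsler_ball:
  assumes complete: mcomplete and q: "q \<in> \<Omega>" and "0 \<le> C" "C < r"
    and F_le: "\<And>t. 0 \<le> t \<Longrightarrow> t \<le> 1 \<Longrightarrow> q + t *\<^sub>R w \<in> \<Omega> \<Longrightarrow> dist\<^sub>F q (q + t *\<^sub>R w) < r \<Longrightarrow>
      F (q + t *\<^sub>R w) w \<le> C"
  shows "q + w \<in> \<Omega> \<and> dist\<^sub>F q (q + w) < r"
proof -
  define \<gamma> where "\<gamma> t = q + t *\<^sub>R w" for t :: real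
  define G where "G = {z \<in> \<Omega>. dist\<^sub>F q z < r}"
  have "open (dist\<^sub>F q -` {..<r} \<inter> \<Omega>)"
    using continuous_on_open_vimage[OF open_domain] continuous_on_dist_finsler[OF q] open_lessThan by blast
  then have "open G"
    by (simp add: G_def Collect_conj_eq vimage_def Int_commute)
  have cont: "continuous_on S \<gamma>" for S
    unfolding \<gamma>_def by (intro continuous_intros)
  have "closed ({0..1} \<inter> \<gamma> -` (- G))"
    by (rule continuous_closed_preimage[OF cont closed_atLeastAtMost closed_Compl[OF \<open>open G\<close>]])
  \<comment> \<open>Compactness provides a least bad parameter, the first exit from the
    ball.\<close>
  then have bad_compact: "compact ({0..1} \<inter> \<gamma> -` (- G))"
    by (simp add: compact_eq_bounded_closed bounded_Int)
  have "{0..1} \<inter> \<gamma> -` (- G) = {}"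
  proof (rule ccontr)
    assume "{0..1} \<inter> \<gamma> -` (- G) \<noteq> {}"
    from compact_attains_inf[OF bad_compact this]
    obtain t0 where "t0 \<in> {0..1} \<inter> \<gamma> -` (- G)" "\<forall>t\<in>{0..1} \<inter> \<gamma> -` (- G). t0 \<le> t" ..
    then have t0: "t0 \<in> {0..1}" "\<gamma> t0 \<notin> G"
      and least: "\<And>t. t \<in> {0..1} \<Longrightarrow> \<gamma> t \<notin> G \<Longrightarrow> t0 \<le> t"
      by auto
    have "\<gamma> 0 \<in> G"
      using q \<open>0 \<le> C\<close> \<open>C < r\<close> by (simp add: G_def \<gamma>_def)
    then have "t0 > 0"
      using t0 by (cases "t0 = 0") auto
    \<comment> \<open>Before the exit the points lie in the ball, where \<open>F_le\<close> applies.
      This bounds the distance covered by \<open>C < r\<close>, which will contradict the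
      exit.\<close>
    have good: "\<gamma> t \<in> \<Omega> \<and> F (\<gamma> t) w \<le> C" if "0 \<le> t" "t < t0" for t
    proof -
      have "\<gamma> t \<in> G"
        using least[of t] that t0(1) by force
      then show ?thesis
        using F_le[of t] that t0(1) by (simp add: G_def \<gamma>_def)
    qed
    have d_le: "dist\<^sub>F (\<gamma> s) (\<gamma> t) \<le> C * \<bar>t - s\<bar>" if "0 \<le> s" "s < t0" "0 \<le> t" "t < t0" for s t
    proof (rule finsler_dist_le_segment)
      fix z assume "z \<in> closed_segment (\<gamma> s) (\<gamma> t)"
      then obtain u where u: "0 \<le> u" "u \<le> 1" "z = (1 - u) *\<^sub>R \<gamma> s + u *\<^sub>R \<gamma> t"
        by (auto simp: in_segment)
      define t' where "t' = (1 - u) * s + u * t"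
      have z: "z = \<gamma> t'"
        by (simp add: u(3) \<gamma>_def t'_def algebra_simps)
      have "t' \<in> closed_segment s t"
        using u(1,2) by (auto simp: in_segment t'_def)
      then have t': "0 \<le> t'" "t' < t0"
        using that by (auto simp: closed_segment_eq_real_ivl split: if_splits)
      have "\<gamma> t - \<gamma> s = (t - s) *\<^sub>R w"
        by (simp add: \<gamma>_def algebra_simps)
      then have "F z (\<gamma> t - \<gamma> s) = \<bar>t - s\<bar> * F z w"
        using good[OF t'] z finsler_metric_scale(2)[OF finsler] by simp
      then show "z \<in> \<Omega> \<and> F z (\<gamma> t - \<gamma> s) \<le> C * \<bar>t - s\<bar>"
        using good[OF t'] z mult_left_mono[of "F z w" C "\<bar>t - s\<bar>"] by (simp add: mult.commute)
    qed (use \<open>0 \<le> C\<close> in simp)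
    \<comment> \<open>These parameters start at 0 and approach \<open>t0\<close> while staying
      strictly below it, where \<open>good\<close> and \<open>d_le\<close> hold.\<close>
    define s where "s n = t0 * (1 - inverse (real (Suc n)))" for n
    have s: "0 \<le> s n" "s n < t0" for n
      using \<open>t0 > 0\<close> by (auto simp: s_def field_simps)
    have s_lim: "s \<longlonglongrightarrow> t0"
      unfolding s_def using tendsto_mult_left[OF LIMSEQ_inverse_real_of_nat_add_minus[of 1], of t0] by simp
    have "MCauchy (\<gamma> \<circ> s)"
      unfolding MCauchy_def
    proof (intro conjI allI impI)
      show "range (\<gamma> \<circ> s) \<subseteq> \<Omega>"
        using good s by auto
      fix \<epsilon> :: real assume "\<epsilon> > 0"
      then obtain N where N: "\<And>m n. m \<ge> N \<Longrightarrow> n \<ge> N \<Longrightarrow> dist (s m) (s n) < \<epsilon> / (C + 1)"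
        using metric_CauchyD[OF LIMSEQ_imp_Cauchy[OF s_lim], of "\<epsilon> / (C + 1)"] \<open>0 \<le> C\<close> by auto
      have "dist\<^sub>F ((\<gamma> \<circ> s) m) ((\<gamma> \<circ> s) n) < \<epsilon>" if "m \<ge> N" "n \<ge> N" for m n
      proof -
        have "dist\<^sub>F ((\<gamma> \<circ> s) m) ((\<gamma> \<circ> s) n) \<le> C * dist (s m) (s n)"
          using d_le[OF s s, of m n] by (simp add: dist_real_def abs_minus_commute)
        also have "\<dots> \<le> (C + 1) * dist (s m) (s n)"
          by (simp add: mult_right_mono)
        also have "\<dots> < \<epsilon>"
          using N[OF that] \<open>0 \<le> C\<close> by (simp add: pos_less_divide_eq mult.commute)
        finally show ?thesis .
      qed
      then show "\<exists>N. \<forall>m n. N \<le> m \<longrightarrow> N \<le> n \<longrightarrow> dist\<^sub>F ((\<gamma> \<circ> s) m) ((\<gamma> \<circ> s) n) < \<epsilon>"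
        by blast
    qed
    then obtain x where "limitin mtopology (\<gamma> \<circ> s) x sequentially"
      using complete[unfolded mcomplete_def, rule_format] by blast
    then have x: "x \<in> \<Omega>" and lim: "\<And>\<epsilon>. \<epsilon> > 0 \<Longrightarrow>
        \<forall>\<^sub>F n in sequentially. (\<gamma> \<circ> s) n \<in> \<Omega> \<and> dist\<^sub>F ((\<gamma> \<circ> s) n) x < \<epsilon>"
      unfolding limitin_metric by blast+
    \<comment> \<open>Convergence in the induced distance implies Euclidean convergence, so the
      limit furnished by completeness must be \<open>\<gamma> t0\<close>.\<close>
    have "(\<gamma> \<circ> s) \<longlonglongrightarrow> x"
      unfolding tendsto_iff
    proof (intro allI impI)
      fix e :: real assume "e > 0"
      obtain \<delta> where "\<delta> > 0" and \<delta>: "\<And>y. y \<in> \<Omega> \<Longrightarrow> dist\<^sub>F x y < \<delta> \<Longrightarrow> norm (y - x) < e"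
        using finsler_ball_within_ball[OF x \<open>e > 0\<close>] by blast
      show "\<forall>\<^sub>F n in sequentially. dist ((\<gamma> \<circ> s) n) x < e"
        using lim[OF \<open>\<delta> > 0\<close>] by eventually_elim (use \<delta> in \<open>simp add: dist_norm commute\<close>)
    qed
    moreover have \<gamma>_lim: "(\<gamma> \<circ> s) \<longlonglongrightarrow> \<gamma> t0"
      unfolding \<gamma>_def comp_def by (intro tendsto_intros s_lim)
    ultimately have "\<gamma> t0 = x"
      using LIMSEQ_unique by blast
    then have "\<gamma> t0 \<in> \<Omega>"
      using x by simp
    have "(\<lambda>n. dist\<^sub>F q ((\<gamma> \<circ> s) n)) \<longlonglongrightarrow> dist\<^sub>F q (\<gamma> t0)"
      using continuous_on_dist_finsler[OF q] \<gamma>_lim \<open>\<gamma> t0 \<in> \<Omega>\<close>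
      by (rule continuous_on_tendsto_compose) (use good s in auto)
    \<comment> \<open>This bound passes to the limit, and \<open>C < r\<close> keeps the exit point
      strictly inside the ball.\<close>
    moreover have "dist\<^sub>F q ((\<gamma> \<circ> s) n) \<le> C" for n
    proof -
      have "dist\<^sub>F q ((\<gamma> \<circ> s) n) \<le> C * s n"
        using d_le[of 0 "s n"] s[of n] \<open>t0 > 0\<close> by (simp add: \<gamma>_def)
      also have "\<dots> \<le> C * 1"
        using s[of n] t0(1) \<open>0 \<le> C\<close> by (intro mult_left_mono) auto
      finally show ?thesis
        by simp
    qed
    ultimately have "dist\<^sub>F q (\<gamma> t0) \<le> C"
      by (intro LIMSEQ_le_const2) auto
    then show False
      using t0(2) \<open>\<gamma> t0 \<in> \<Omega>\<close> \<open>C < r\<close> by (simp add: G_def)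
  qed
  then have "1 \<notin> {0..1} \<inter> \<gamma> -` (- G)"
    by (simp only: empty_iff not_False_eq_True)
  then have "\<gamma> 1 \<in> G"
    by simp
  then show ?thesis
    by (simp add: G_def \<gamma>_def)
qed

section \<open>A bound for the rescalings that is uniform over the automorphisms\<close>

lemma rescaling_norm_le:
  assumes complete: mcomplete and inv: "invariant_metric \<Omega> F" and p: "p \<in> \<Omega>"
    and "r > 0" and M: "\<And>y. y \<in> \<Omega> \<Longrightarrow> dist\<^sub>F p y < r \<Longrightarrow> norm y \<le> M"
    and "l > 0" and dom: "\<And>x. x \<in> \<Omega> \<Longrightarrow>
      (\<lambda>y. y - x) ` finsler_ball \<Omega> F x (R + r) \<subseteq> (\<lambda>v. l *\<^sub>R v) ` indicatrix F x"
    and \<phi>: "\<phi> \<in> holomorphic_Aut \<Omega>" and y: "y \<in> \<Omega>" "dist\<^sub>F p y < R"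
  shows "norm (rescaling p \<phi> y) \<le> real CARD('n) * M / min (1 / 2) (r / (4 * l))"
proof -
  note aut = open_domain inv \<phi>
  define \<psi> where "\<psi> = inv_into \<Omega> \<phi>"
  define q u where "q = \<phi> p" and "u = \<phi> y - \<phi> p"
  \<comment> \<open>The value 1/2 keeps \<open>cmod (1 - \<xi>)\<close> at least 1/2 on the disc;
    \<open>r / (4 * l)\<close> gives \<open>2 * l * c \<le> r / 2\<close>, hence less than
    \<open>r\<close>.\<close>
  define c where "c = min (1 / 2) (r / (4 * l))"
  have "c > 0" "c \<le> 1 / 2"
    using \<open>r > 0\<close> \<open>l > 0\<close> by (auto simp: c_def)
  have "2 * l * c < r"
  proof -
    have "2 * l * c \<le> 2 * l * (r / (4 * l))"
      using \<open>l > 0\<close> by (intro mult_left_mono) (auto simp: c_def)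
    also have "\<dots> < r"
      using \<open>l > 0\<close> \<open>r > 0\<close> by simp
    finally show ?thesis .
  qed
  have q\<Omega>: "q \<in> \<Omega>" and \<phi>y: "\<phi> y \<in> \<Omega>"
    using holomorphic_Aut_image(1)[OF aut] p y by (auto simp: q_def)
  have "dist\<^sub>F q (\<phi> y) < R"
    using finsler_dist_holomorphic_Aut[OF aut p y(1)] y(2) by (simp add: q_def)
  have F_u: "F x u \<le> 2 * l" if x: "x \<in> \<Omega>" "dist\<^sub>F q x < r" "x = q + \<xi> *s u" "cmod \<xi> \<le> c" for x \<xi>
  proof -
    \<comment> \<open>This is why domination is assumed for the radius \<open>R + r\<close>: it is
      applied at the moving point \<open>x\<close>, not only at \<open>q\<close>.\<close>
    have "dist\<^sub>F x (\<phi> y) < R + r"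
      using triangle[OF x(1) q\<Omega> \<phi>y] x(2) \<open>dist\<^sub>F q (\<phi> y) < R\<close> by (simp add: commute)
    then have "\<phi> y - x \<in> (\<lambda>v. l *\<^sub>R v) ` indicatrix F x"
      using dom[OF x(1)] \<phi>y by (auto simp: finsler_ball_def)
    then obtain v where v: "F x v < 1" "\<phi> y - x = l *\<^sub>R v"
      by (auto simp: indicatrix_def)
    have "F x (\<phi> y - x) = l * F x v"
      using v(2) finsler_metric_scale(2)[OF finsler x(1)] \<open>l > 0\<close> by simp
    also have "\<dots> \<le> l"
      using v(1) \<open>l > 0\<close> by simp
    finally have "F x (\<phi> y - x) \<le> l" .
    moreover have "\<phi> y - x = (1 - \<xi>) *s u"
      by (simp add: x(3) u_def q_def vec_eq_iff algebra_simps)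
    ultimately have "F x ((1 - \<xi>) *s u) \<le> l"
      by (simp only:)
    then have "cmod (1 - \<xi>) * F x u \<le> l"
      unfolding finsler_metric_scale(1)[OF finsler x(1)] .
    moreover have "1 / 2 \<le> cmod (1 - \<xi>)"
      using norm_triangle_ineq2[of 1 \<xi>] x(4) \<open>c \<le> 1 / 2\<close> by simp
    then have "1 / 2 * F x u \<le> cmod (1 - \<xi>) * F x u"
      by (rule mult_right_mono[OF _ finsler_metric_nonneg[OF finsler x(1)]])
    ultimately show ?thesis
      by simp
  qed
  \<comment> \<open>The disc is swept out by the radial segments from \<open>q\<close> to
    \<open>q + \<zeta> *s u\<close>; along each of them homogeneity turns \<open>F_u\<close> into
    the bound \<open>2 * l * c\<close>.\<close>
  have disc: "q + \<zeta> *s u \<in> \<Omega> \<and> dist\<^sub>F q (q + \<zeta> *s u) < r" if \<zeta>: "cmod \<zeta> \<le> c" for \<zeta>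
  proof (rule segment_within_finsler_ball[OF complete q\<Omega> _ \<open>2 * l * c < r\<close>])
    fix t :: real
    assume t: "0 \<le> t" "t \<le> 1" and x: "q + t *\<^sub>R (\<zeta> *s u) \<in> \<Omega>" "dist\<^sub>F q (q + t *\<^sub>R (\<zeta> *s u)) < r"
    have "q + t *\<^sub>R (\<zeta> *s u) = q + (of_real t * \<zeta>) *s u"
      by (simp add: scaleR_vector_scalar_mult vector_smult_assoc)
    moreover have "cmod (of_real t * \<zeta>) \<le> c"
      using t \<zeta> mult_left_le_one_le[of "cmod \<zeta>" t] by (simp add: norm_mult)
    ultimately have "F (q + t *\<^sub>R (\<zeta> *s u)) u \<le> 2 * l"
      by (rule F_u[OF x])
    then have "cmod \<zeta> * F (q + t *\<^sub>R (\<zeta> *s u)) u \<le> c * (2 * l)"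
      using \<zeta> \<open>c > 0\<close> finsler_metric_nonneg[OF finsler x(1)] by (intro mult_mono) auto
    then show "F (q + t *\<^sub>R (\<zeta> *s u)) (\<zeta> *s u) \<le> 2 * l * c"
      using finsler_metric_scale(1)[OF finsler x(1)] by (simp add: mult.commute mult.left_commute)
  qed (use \<open>l > 0\<close> \<open>c > 0\<close> in simp)
  \<comment> \<open>The inverse is an isometry, so it maps the disc into the ball of radius
    \<open>r\<close> around \<open>p\<close>, where norms are at most \<open>M\<close>.\<close>
  have "norm (jacobian \<psi> (at q) *v u) \<le> real CARD('n) * M / c"
  proof (rule cauchy_estimate_along_line[OF \<open>c > 0\<close>])
    show "holomorphic_map_on \<psi> ((\<lambda>\<zeta>. q + \<zeta> *s u) ` cball 0 c)"
      unfolding \<psi>_def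
      by (rule holomorphic_map_on_subset[OF holomorphic_Aut_holomorphic(2)[OF aut]]) (use disc in auto)
    fix \<zeta> assume "cmod \<zeta> = c"
    then have x: "q + \<zeta> *s u \<in> \<Omega>" "dist\<^sub>F q (q + \<zeta> *s u) < r"
      using disc[of \<zeta>] by simp_all
    have "\<psi> (q + \<zeta> *s u) \<in> \<Omega>"
      using holomorphic_Aut_image(2)[OF aut] x(1) by (auto simp: \<psi>_def)
    moreover have "dist\<^sub>F p (\<psi> (q + \<zeta> *s u)) < r"
      using finsler_dist_holomorphic_Aut[OF aut p calculation] x
        holomorphic_Aut_inverse(2)[OF aut x(1)] by (simp add: q_def \<psi>_def)
    ultimately show "norm (\<psi> (q + \<zeta> *s u)) \<le> M"
      by (rule M)
  qed
  moreover have "matrix_inv (jacobian \<phi> (at p)) = jacobian \<psi> (at q)"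
    unfolding \<psi>_def q_def
    by (rule matrix_inv_eqI[OF jacobian_inv_into(2,1)[OF aut p]])
  ultimately show ?thesis
    by (simp add: rescaling_def u_def c_def)
qed

end

section \<open>Normality of the rescalings\<close>

theorem proposition2p5:
  fixes \<Omega> :: "(complex ^ 'n) set" and p :: "complex ^ 'n"
    and F :: "complex ^ 'n \<Rightarrow> complex ^ 'n \<Rightarrow> real"
  assumes "open \<Omega>" and "connected \<Omega>" and "p \<in> \<Omega>"
    and "finsler_metric \<Omega> F" and "invariant_metric \<Omega> F"
    and "uniformly_dominated \<Omega> F"
  shows "normal_family \<Omega> {rescaling p \<phi> | \<phi>. \<phi> \<in> holomorphic_Aut \<Omega>}"
proof -
  interpret Metric_space \<Omega> "finsler_dist \<Omega> F"
    using assms(6) by (simp add: uniformly_dominated_def finsler_complete_def)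
  interpret finsler_domain \<Omega> F
    by unfold_locales (use assms in auto)
  have complete: mcomplete
    using assms(6) by (simp add: uniformly_dominated_def finsler_complete_def)
  \<comment> \<open>The Euclidean radius 1 is an arbitrary choice; it only makes the ball around
    \<open>p\<close> bounded.\<close>
  obtain r where "r > 0" and r: "\<And>y. y \<in> \<Omega> \<Longrightarrow> finsler_dist \<Omega> F p y < r \<Longrightarrow> norm (y - p) < 1"
    using finsler_ball_within_ball[OF \<open>p \<in> \<Omega>\<close> zero_less_one] by blast
  have M: "norm y \<le> norm p + 1" if "y \<in> \<Omega>" "finsler_dist \<Omega> F p y < r" for y
    using r[OF that] norm_triangle_sub[of y p] by linarith
  have bound: "\<exists>B. \<forall>\<phi>\<in>holomorphic_Aut \<Omega>. \<forall>z\<in>K. norm (rescaling p \<phi> z) \<le> B"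
    if K: "compact K" "K \<subseteq> \<Omega>" for K
  proof -
    \<comment> \<open>By continuity of the distance, a compact set lies in some ball around
      \<open>p\<close>, so one \<open>R\<close>, and hence one \<open>l\<close>, serves all of
      \<open>K\<close> and every automorphism.\<close>
    have "bounded (finsler_dist \<Omega> F p ` K)"
      using continuous_on_subset[OF continuous_on_dist_finsler[OF \<open>p \<in> \<Omega>\<close>] K(2)] K(1)
      by (intro compact_imp_bounded compact_continuous_image)
    then obtain R where "R > 0" and R: "\<And>z. z \<in> K \<Longrightarrow> finsler_dist \<Omega> F p z < R"
      unfolding bounded_pos_less by auto
    have "R + r > 0"
      using \<open>R > 0\<close> \<open>r > 0\<close> by simp
    with assms(6) have "\<exists>l>0. \<forall>x\<in>\<Omega>.
        (\<lambda>y. y - x) ` finsler_ball \<Omega> F x (R + r) \<subseteq> (\<lambda>v. l *\<^sub>R v) ` indicatrix F x"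
      by (simp add: uniformly_dominated_def)
    then obtain l where "l > 0" and "\<forall>x\<in>\<Omega>.
        (\<lambda>y. y - x) ` finsler_ball \<Omega> F x (R + r) \<subseteq> (\<lambda>v. l *\<^sub>R v) ` indicatrix F x"
      by (elim exE conjE)
    note l = bspec[OF this(2)]
    have "norm (rescaling p \<phi> z) \<le> real CARD('n) * (norm p + 1) / min (1 / 2) (r / (4 * l))"
      if "\<phi> \<in> holomorphic_Aut \<Omega>" "z \<in> K" for \<phi> z
    proof (rule rescaling_norm_le[OF complete \<open>invariant_metric \<Omega> F\<close> \<open>p \<in> \<Omega>\<close> \<open>r > 0\<close> M \<open>l > 0\<close> l that(1)])
      show "finsler_dist \<Omega> F p z < R"
        by (rule R[OF that(2)])
    qed (use that K in auto)
    then show ?thesis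
      by blast
  qed
  have hol: "holomorphic_map_on (rescaling p \<phi>) \<Omega>" if "\<phi> \<in> holomorphic_Aut \<Omega>" for \<phi>
    using that unfolding rescaling_def holomorphic_Aut_def by (auto intro: holomorphic_map_on_affine)
  show ?thesis
    unfolding normal_family_def
  proof (intro conjI ballI allI impI)
    show "holomorphic_map_on f \<Omega>" if "f \<in> {rescaling p \<phi> | \<phi>. \<phi> \<in> holomorphic_Aut \<Omega>}" for f
      using that hol by auto
    fix f :: "nat \<Rightarrow> complex ^ 'n \<Rightarrow> complex ^ 'n"
    assume "range f \<subseteq> {rescaling p \<phi> | \<phi>. \<phi> \<in> holomorphic_Aut \<Omega>}"
    then have f: "\<exists>\<phi>\<in>holomorphic_Aut \<Omega>. f n = rescaling p \<phi>" for n
      by blast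
    show "\<exists>r g. strict_mono r \<and> holomorphic_map_on g \<Omega> \<and>
        (\<forall>K. compact K \<and> K \<subseteq> \<Omega> \<longrightarrow> uniform_limit K (f \<circ> r) g sequentially)"
    proof (rule montel_several_variables[OF \<open>open \<Omega>\<close>])
      show "holomorphic_map_on (f n) \<Omega>" for n
        using f[of n] hol by auto
      show "\<exists>B. \<forall>n. \<forall>z\<in>K. norm (f n z) \<le> B" if "compact K" "K \<subseteq> \<Omega>" for K
        using bound[OF that] f by metis
    qed
  qed
qed

end
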